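(* Let $k$ be an infinite field. Fix integers $e\ge3$ and $i$ with $1\le i\le \frac e2$, and let $f_{e,i}(r)$ denote the least possible value in degree $i$ of the Hilbert function of an artinian Gorenstein standard graded $k$-algebra with socle degree $e$ and codimension $r$. Then \[ \lim_{r\to\infty}\frac{f_{e,i}(r)}{r^{\frac{e-i}{e-1}}}= \begin{cases} \dfrac{\left((e-1)!\right)^{\frac{e-i}{e-1}}}{(e-i)!} & \text{if } i<\frac e2,\\[2ex] 2\cdot\dfrac{\left((e-1)!\right)^{\frac{e/2}{e-1}}}{(e/2)!} & \text{if } i=\frac e2 . \end{cases} \]
   Context: An artinian standard graded algebra $A=R/I$, $R=k[x_1,\dots,x_r]$, $I$ homogeneous containing no linear forms, has codimension $r$ (so $\dim_k A_1=r$). Its Hilbert function is $h_d=\dim_k A_d$, and its socle degree $e$ is the largest $d$ with $h_d\neq0$. *)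

theory Defs
  imports Complex_Main "HOL-Library.Poly_Mapping"
begin

text \<open>Polynomials over a field 'k in countably many variables x_0, x_1, ...:
  finitely supported maps from monomials (exponent vectors nat =>0 nat) to coefficients.
  The polynomial ring R = k[x_0,...,x_{r-1}] is the subset of polynomials only
  involving variables with index < r.\<close>

type_synonym 'k mpoly = "(nat \<Rightarrow>\<^sub>0 nat) \<Rightarrow>\<^sub>0 'k"

definition mon_deg :: "(nat \<Rightarrow>\<^sub>0 nat) \<Rightarrow> nat" where
  "mon_deg m = (\<Sum>j\<in>Poly_Mapping.keys m. Poly_Mapping.lookup m j)"

definition poly_ring :: "nat \<Rightarrow> ('k::field) mpoly set" where
  "poly_ring r = {p. \<forall>m\<in>Poly_Mapping.keys p. Poly_Mapping.keys m \<subseteq> {..<r}}"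

definition Var :: "nat \<Rightarrow> ('k::field) mpoly" where
  "Var j = Poly_Mapping.single (Poly_Mapping.single j 1) 1"

definition const :: "'k::field \<Rightarrow> 'k mpoly" where
  "const c = Poly_Mapping.single 0 c"

definition hom_part :: "nat \<Rightarrow> nat \<Rightarrow> ('k::field) mpoly set" where
  "hom_part r d = {p \<in> poly_ring r. \<forall>m\<in>Poly_Mapping.keys p. mon_deg m = d}"

definition hcomp :: "nat \<Rightarrow> ('k::field) mpoly \<Rightarrow> 'k mpoly" where
  "hcomp d p = Poly_Mapping.mapp (\<lambda>m c. if mon_deg m = d then c else 0) p"

definition is_ideal :: "nat \<Rightarrow> ('k::field) mpoly set \<Rightarrow> bool" where
  "is_ideal r I \<longleftrightarrow> I \<subseteq> poly_ring r \<and> 0 \<in> I \<and>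
     (\<forall>p\<in>I. \<forall>q\<in>I. p + q \<in> I) \<and> (\<forall>p\<in>I. \<forall>q\<in>poly_ring r. q * p \<in> I)"

definition homogeneous_ideal :: "nat \<Rightarrow> ('k::field) mpoly set \<Rightarrow> bool" where
  "homogeneous_ideal r I \<longleftrightarrow> is_ideal r I \<and> (\<forall>p\<in>I. \<forall>d. hcomp d p \<in> I)"

definition indep_mod :: "('k::field) mpoly set \<Rightarrow> 'k mpoly set \<Rightarrow> bool" where
  "indep_mod W B \<longleftrightarrow> (\<forall>c. (\<Sum>b\<in>B. const (c b) * b) \<in> W \<longrightarrow> (\<forall>b\<in>B. c b = 0))"

text \<open>dim_k (V + W)/W, i.e. the dimension of the image of the subspace V in R/W
  (used only where this is finite).\<close>
definition reldim :: "('k::field) mpoly set \<Rightarrow> 'k mpoly set \<Rightarrow> nat" where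
  "reldim V W = Sup {card B | B. finite B \<and> B \<subseteq> V \<and> indep_mod W B}"

definition hilb :: "nat \<Rightarrow> ('k::field) mpoly set \<Rightarrow> nat \<Rightarrow> nat" where
  "hilb r I d = reldim (hom_part r d) I"

definition is_artinian :: "nat \<Rightarrow> ('k::field) mpoly set \<Rightarrow> bool" where
  "is_artinian r I \<longleftrightarrow> (\<exists>N. \<forall>d\<ge>N. hom_part r d \<subseteq> I)"

text \<open>Preimage in R of the socle (0 :_A m) of A = R/I, m = (x_0,...,x_{r-1}).\<close>
definition socle_pre :: "nat \<Rightarrow> ('k::field) mpoly set \<Rightarrow> 'k mpoly set" where
  "socle_pre r I = {p \<in> poly_ring r. \<forall>j<r. Var j * p \<in> I}"

text \<open>Artinian Gorenstein standard graded algebra R/I of codimension r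
  (I homogeneous, containing no nonzero linear forms) with socle degree e.\<close>
definition AG_algebra :: "nat \<Rightarrow> nat \<Rightarrow> ('k::field) mpoly set \<Rightarrow> bool" where
  "AG_algebra r e I \<longleftrightarrow> homogeneous_ideal r I \<and> I \<inter> hom_part r 1 = {0}
     \<and> is_artinian r I \<and> reldim (socle_pre r I) I = 1
     \<and> hilb r I e \<noteq> 0 \<and> (\<forall>d>e. hilb r I d = 0)"

definition f_min :: "('k::field) itself \<Rightarrow> nat \<Rightarrow> nat \<Rightarrow> nat \<Rightarrow> nat" where
  "f_min _ e i r = Inf {hilb r I i | I :: 'k mpoly set. AG_algebra r e I}"

end

theory Submission
  imports Defs "HOL-Library.Function_Algebras"
begin

text \<open>
  By Macaulay duality an artinian Gorenstein algebra of socle degree \<open>e\<close> is determined by one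
  linear functional \<open>\<Phi>\<close> on forms of degree \<open>e\<close>, and its Hilbert function in degree \<open>i\<close> is the
  dimension of the space \<open>D\<^sub>i\<close> of \<open>i\<close>-fold contractions of \<open>\<Phi>\<close>. Write \<open>p\<^sub>d(x)\<close> for the number
  \<open>x (x + 1) \<dots> (x + d - 1) / d!\<close> of monomials of degree \<open>d\<close> in \<open>x\<close> variables, extended to real \<open>x\<close>.

  Lower bound: a real-variable form of Green's hyperplane restriction theorem gives a linear form \<open>l\<close>
  such that contraction by \<open>l\<close> has rank at least \<open>p\<^bsub>e-k-1\<^esub>(x)\<close> on \<open>D\<^sub>k\<close> whenever
  \<open>dim D\<^sub>k \<ge> p\<^bsub>e-k\<^esub>(x)\<close>. Starting from \<open>dim D\<^sub>1 = r = p\<^bsub>e-1\<^esub>(x)\<close> this yields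
  \<open>dim D\<^sub>i \<ge> p\<^bsub>e-i\<^esub>(x)\<close>. In the middle degree \<open>e = 2 i\<close> the contraction by \<open>l\<close> has the same rank on
  \<open>D\<^bsub>i-1\<^esub>\<close> and on \<open>D\<^sub>i\<close> (row rank equals column rank), and its kernel on \<open>D\<^sub>i\<close> contains the
  contractions of its kernel on \<open>D\<^bsub>i-1\<^esub>\<close>; both contributions are asymptotically \<open>p\<^sub>i(x)\<close>, whence
  the factor 2.

  Upper bound: take \<open>\<Phi> = \<Sum> y\<^sub>j M\<^sub>j\<close> with distinct monomials \<open>M\<^sub>j\<close> of degree \<open>e - 1\<close> in few variables
  \<open>x\<^sub>0, \<dots>, x\<^bsub>m-1\<^esub>\<close>; then \<open>dim D\<^sub>i \<le> p\<^sub>i(m) + p\<^bsub>e-i\<^esub>(m)\<close>.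
\<close>

section \<open>Finite-dimensional subspaces and pencils of linear maps\<close>

text \<open>A locale of its own, so that the facts below do not enter the existing interpretations of
  \<open>vector_space\<close>.\<close>

locale lin_space = vector_space scale
  for scale :: "'a::field \<Rightarrow> 'b::ab_group_add \<Rightarrow> 'b"
begin

definition fin_dim :: "'b set \<Rightarrow> bool" where
  "fin_dim D \<longleftrightarrow> (\<exists>B. finite B \<and> D \<subseteq> span B)"

lemma fin_dim_subset: "fin_dim E \<Longrightarrow> D \<subseteq> E \<Longrightarrow> fin_dim D"
  unfolding fin_dim_def by blast

lemma fin_dim_basis:
  assumes "subspace D" "fin_dim D"
  obtains B where "finite B" "B \<subseteq> D" "independent B" "span B = D" "card B = dim D"
proof -
  obtain B where B: "B \<subseteq> D" "independent B" "D \<subseteq> span B" "card B = dim D"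
    using basis_exists by blast
  moreover have "finite B"
    using assms(2) B independent_span_bound unfolding fin_dim_def by (meson subset_trans)
  ultimately show thesis
    using that span_subspace assms(1) by blast
qed

lemma independent_card_le_dim:
  assumes "fin_dim D" "B \<subseteq> D" "independent B"
  shows "finite B \<and> card B \<le> dim D"
proof -
  obtain C where C: "finite C" "D \<subseteq> span C" using assms(1) unfolding fin_dim_def by blast
  obtain B' where B': "B \<subseteq> B'" "B' \<subseteq> D" "independent B'" "D \<subseteq> span B'"
    using maximal_independent_subset_extend assms(2,3) by blast
  have "finite B'" using B' C independent_span_bound by (meson subset_trans)
  moreover have "card B' = dim D" using B' basis_card_eq_dim by blast
  ultimately show ?thesis using B' card_mono finite_subset by metis
qed

lemma dim_mono_fin: "fin_dim E \<Longrightarrow> D \<subseteq> E \<Longrightarrow> dim D \<le> dim E"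
  by (metis basis_exists independent_card_le_dim subset_trans)

lemma dim_pos:
  assumes "fin_dim D" "x \<in> D" "x \<noteq> 0"
  shows "0 < dim D"
  using independent_card_le_dim[of D "{x}"] assms by auto

lemma dim_pos_nonzero:
  assumes "0 < dim D"
  obtains x where "x \<in> D" "x \<noteq> 0"
proof -
  have "\<not> D \<subseteq> span {}"
  proof
    assume "D \<subseteq> span {}"
    then have "dim D \<le> card ({} :: 'b set)" by (rule dim_le_card) simp
    then show False using assms by simp
  qed
  then show thesis using that by auto
qed

text \<open>A repetition \<open>u s = u t\<close> would give a relation with coefficients 1 and -1,
  so the hypothesis on the indexed family also yields injectivity, and the index set and the image
  have the same cardinality.\<close>

lemma independent_familyI:
  assumes F: "finite F"
    and ind: "\<And>a t. (\<Sum>t\<in>F. scale (a t) (u t)) = 0 \<Longrightarrow> t \<in> F \<Longrightarrow> a t = 0"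
  shows "inj_on u F" "independent (u ` F)"
proof -
  show inj: "inj_on u F"
  proof (rule inj_onI, rule ccontr)
    fix s t assume st: "s \<in> F" "t \<in> F" "u s = u t" "s \<noteq> t"
    let ?a = "\<lambda>x. if x = s then 1 else if x = t then - 1 else 0 :: 'a"
    have "(\<Sum>x\<in>F. scale (?a x) (u x)) = (\<Sum>x\<in>{s,t}. scale (?a x) (u x))"
      using st F by (intro sum.mono_neutral_right) auto
    also have "\<dots> = 0" using st by simp
    finally show False using ind[of ?a s] st by simp
  qed
  show "independent (u ` F)"
  proof (rule independent_if_scalars_zero)
    fix g x assume g: "(\<Sum>x\<in>u ` F. scale (g x) x) = 0" and x: "x \<in> u ` F"
    then have "(\<Sum>t\<in>F. scale (g (u t)) (u t)) = 0" by (simp add: sum.reindex[OF inj])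
    then show "g x = 0" using ind[of "\<lambda>t. g (u t)"] x by auto
  qed (use F in simp)
qed

lemma fin_dim_span: "finite B \<Longrightarrow> fin_dim (span B)"
  unfolding fin_dim_def by blast

lemma fin_dim_image:
  assumes "Vector_Spaces.linear scale scale f" "fin_dim D"
  shows "fin_dim (f ` D)"
proof -
  interpret f: Vector_Spaces.linear scale scale f by fact
  show ?thesis using assms(2) f.spans_image unfolding fin_dim_def by blast
qed

lemma subspace_linear_image:
  assumes "Vector_Spaces.linear scale scale f" "subspace D"
  shows "subspace (f ` D)"
proof -
  interpret f: Vector_Spaces.linear scale scale f by fact
  show ?thesis using assms(2) f.subspace_image by blast
qed

lemma subspace_ker:
  assumes "Vector_Spaces.linear scale scale f" "subspace D"
  shows "subspace {x \<in> D. f x = 0}"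
proof -
  interpret f: Vector_Spaces.linear scale scale f by fact
  show ?thesis using assms(2) f.subspace_kernel subspace_inter[of D "{x. f x = 0}"]
    by (simp add: Int_def)
qed

lemma dim_image_inj:
  assumes "Vector_Spaces.linear scale scale f" "subspace D" "fin_dim D" "inj_on f D"
  shows "dim (f ` D) = dim D"
proof -
  interpret f: Vector_Spaces.linear scale scale f by fact
  obtain B where B: "finite B" "B \<subseteq> D" "independent B" "span B = D" "card B = dim D"
    using fin_dim_basis assms by metis
  have "independent (f ` B)" using f.independent_injective_image B assms(4) by auto
  moreover have "span (f ` B) = f ` D" using f.span_image B by simp
  ultimately show ?thesis
    by (metis B(2,5) assms(4) card_image dim_span_eq_card_independent inj_on_subset)
qed

text \<open>A basis of the kernel is extended to one of \<open>D\<close>, and the added vectors span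
  \<open>U\<close>. The complement is exported along with the dimension count because the pencil
  arguments need a subspace on which the map is injective and keeps its whole rank.\<close>

lemma rank_nullity_complement:
  assumes f: "Vector_Spaces.linear scale scale f" and D: "subspace D" "fin_dim D"
  obtains U where "subspace U" "U \<subseteq> D" "inj_on f U" "f ` U = f ` D"
    "dim D = dim U + dim {x \<in> D. f x = 0}" "dim U = dim (f ` D)"
proof -
  interpret f: Vector_Spaces.linear scale scale f by fact
  let ?N = "{x \<in> D. f x = 0}"
  have N: "subspace ?N" "fin_dim ?N" "?N \<subseteq> D"
    using subspace_ker[OF f D(1)] fin_dim_subset[OF D(2), of ?N] by auto
  obtain B0 where B0: "finite B0" "B0 \<subseteq> ?N" "independent B0" "span B0 = ?N" "card B0 = dim ?N"
    by (rule fin_dim_basis[OF N(1,2)])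
  obtain B where B: "B0 \<subseteq> B" "B \<subseteq> D" "independent B" "D \<subseteq> span B"
    using maximal_independent_subset_extend[of B0 D] B0 by blast
  have sB: "span B = D" using B D span_subspace by blast
  have fB: "finite B" using independent_card_le_dim B D by blast
  have cB: "card B = dim D" using B basis_card_eq_dim by blast
  let ?U = "span (B - B0)"
  have U: "subspace ?U" "?U \<subseteq> D"
    using sB span_mono[of "B - B0" B] by auto
  have inj: "inj_on f ?U"
    unfolding f.inj_on_iff_eq_0[OF U(1)]
  proof safe
    fix x assume x: "x \<in> ?U" "f x = 0"
    then have x0: "x \<in> span B0" using U B0 by auto
    \<comment> \<open>Both \<open>B0\<close> and \<open>B - B0\<close> can express \<open>x\<close>,
      so every coordinate of \<open>x\<close> with respect to \<open>B\<close> vanishes.\<close>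
    have "representation B x = representation B0 x"
      using representation_extend[OF B(3) x0 B(1)] .
    moreover have "representation B x = representation (B - B0) x"
      using representation_extend[OF B(3) x(1)] by blast
    ultimately have "\<And>b. representation B x b = 0"
      using representation_ne_zero[of B0 x] representation_ne_zero[of "B - B0" x] by (metis DiffD2)
    then show "x = 0"
      using sum_nonzero_representation_eq[OF B(3), of x] x U sB by auto
  qed
  have img: "f ` ?U = f ` D"
  proof (rule subset_antisym)
    show "f ` D \<subseteq> f ` ?U"
    proof
      fix y assume "y \<in> f ` D"
      then obtain x where x: "x \<in> span (B0 \<union> (B - B0))" "y = f x"
        using sB B(1) by (auto simp: Un_absorb1)
      then obtain u v where uv: "x = u + v" "u \<in> span B0" "v \<in> ?U" unfolding span_Un by blast
      then have "f x = f v" using B0 by (auto simp: f.add)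
      then show "y \<in> f ` ?U" using uv x by auto
    qed
  qed (use U in auto)
  have "independent (B - B0)" using B independent_mono by blast
  then have dU: "dim ?U = card (B - B0)" using dim_span_eq_card_independent by blast
  moreover have "card B = card (B - B0) + card B0"
    using fB B(1) B0(1) by (simp add: card_Diff_subset card_mono)
  ultimately have "dim D = dim ?U + dim ?N" using cB B0(5) by simp
  moreover have "dim ?U = dim (f ` D)"
    using dim_image_inj[OF f U(1) _ inj] img fin_dim_subset[OF D(2) U(2)] by simp
  ultimately show thesis using that[OF U inj img] by blast
qed

lemma rank_nullity:
  assumes f: "Vector_Spaces.linear scale scale f" and D: "subspace D" "fin_dim D"
  shows "dim D = dim (f ` D) + dim {x \<in> D. f x = 0}"
  using rank_nullity_complement[OF assms] by metis

section \<open>Rank in a pencil of linear maps\<close>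

text \<open>Kernel vectors of \<open>T + t S\<close> for different \<open>t\<close> behave like eigenvectors for different
  eigenvalues.\<close>

lemma singular_pencil_independent:
  assumes T: "Vector_Spaces.linear scale scale T" and S: "Vector_Spaces.linear scale scale S"
    and U: "subspace U" "inj_on T U"
    and F: "finite F" and u: "\<And>t. t \<in> F \<Longrightarrow> u t \<in> U \<and> u t \<noteq> 0 \<and> T (u t) + scale t (S (u t)) = 0"
    and rel: "(\<Sum>t\<in>F. scale (a t) (u t)) = 0" and "t \<in> F"
  shows "a t = 0"
  using F u rel \<open>t \<in> F\<close>
proof (induction F arbitrary: a t rule: finite_induct)
  case (insert s F)
  interpret T: Vector_Spaces.linear scale scale T by fact
  interpret S: Vector_Spaces.linear scale scale S by fact
  have nz: "t \<noteq> 0" if "t \<in> insert s F" for t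
    using insert.prems(1)[OF that] U T.inj_on_iff_eq_0[OF U(1)] by auto
  have Su: "S (u t) = - scale (inverse t) (T (u t))" if "t \<in> insert s F" for t
  proof -
    have "scale t (S (u t)) = - T (u t)" using insert.prems(1)[OF that]
      by (simp add: eq_neg_iff_add_eq_0 add.commute)
    then have "scale (inverse t) (scale t (S (u t))) = scale (inverse t) (- T (u t))" by simp
    then show ?thesis using nz[OF that] by simp
  qed
  \<comment> \<open>Up to sign, \<open>S\<close> turns the relation into \<open>T\<close> of the
    combination with coefficients \<open>a t / t\<close>, which must then vanish as \<open>T\<close>
    is injective on \<open>U\<close>. Subtracting \<open>1 / s\<close> times the original relation
    removes the term of \<open>s\<close>.\<close>
  have "0 = S (\<Sum>t\<in>insert s F. scale (a t) (u t))"
    using insert.prems(2) by simp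
  also have "\<dots> = (\<Sum>t\<in>insert s F. scale (a t) (- scale (inverse t) (T (u t))))"
    unfolding S.sum S.scale using Su by (intro sum.cong) auto
  also have "\<dots> = - T (\<Sum>t\<in>insert s F. scale (a t * inverse t) (u t))"
    unfolding T.sum T.scale by (simp add: sum_negf)
  finally have "T (\<Sum>t\<in>insert s F. scale (a t * inverse t) (u t)) = 0" by simp
  moreover have "(\<Sum>t\<in>insert s F. scale (a t * inverse t) (u t)) \<in> U"
    using insert.prems(1) U by (intro subspace_sum subspace_scale) auto
  ultimately have "(\<Sum>t\<in>insert s F. scale (a t * inverse t) (u t)) = 0"
    using U T.inj_on_iff_eq_0[OF U(1)] by blast
  then have "(\<Sum>t\<in>insert s F. scale (a t * inverse t) (u t))
      - scale (inverse s) (\<Sum>t\<in>insert s F. scale (a t) (u t)) = 0"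
    using insert.prems(2) by simp
  then have "(\<Sum>t\<in>insert s F. scale (a t * (inverse t - inverse s)) (u t)) = 0"
    unfolding scale_sum_right sum_subtractf[symmetric] scale_scale scale_left_diff_distrib[symmetric]
    by (simp only: right_diff_distrib mult.commute[of "inverse s"])
  then have "(\<Sum>t\<in>F. scale (a t * (inverse t - inverse s)) (u t)) = 0"
    using insert.hyps by simp
  then have "a t * (inverse t - inverse s) = 0" if "t \<in> F" for t
    using insert.IH[of "\<lambda>t. a t * (inverse t - inverse s)"] that insert.prems(1) by blast
  then have aF: "a t = 0" if "t \<in> F" for t
    using that insert.hyps(2) nz by fastforce
  then have "scale (a s) (u s) = 0" using insert.prems(2) insert.hyps by simp
  then have "a s = 0" using insert.prems(1)[of s] by simp
  then show ?case using aF insert.prems(3) by blast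
qed auto

text \<open>Kernel vectors for distinct parameters are independent, so there are at most
  \<open>dim U\<close> exceptional values.\<close>

lemma finite_singular_pencil:
  assumes T: "Vector_Spaces.linear scale scale T" and S: "Vector_Spaces.linear scale scale S"
    and U: "subspace U" "fin_dim U" "inj_on T U"
  shows "finite {t. \<exists>u\<in>U. u \<noteq> 0 \<and> T u + scale t (S u) = 0}" (is "finite ?E")
proof (rule ccontr)
  assume "infinite ?E"
  then obtain F where F: "F \<subseteq> ?E" "finite F" "card F = Suc (dim U)"
    using infinite_arbitrarily_large by blast
  then have "\<forall>t\<in>F. \<exists>u. u \<in> U \<and> u \<noteq> 0 \<and> T u + scale t (S u) = 0" by blast
  then obtain u where u: "\<And>t. t \<in> F \<Longrightarrow> u t \<in> U \<and> u t \<noteq> 0 \<and> T (u t) + scale t (S (u t)) = 0"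
    by metis
  note ind = singular_pencil_independent[OF T S U(1,3) F(2) u]
  have inj: "inj_on u F" and "independent (u ` F)"
    using ind by (auto intro!: independent_familyI[OF F(2)])
  then have "card (u ` F) \<le> dim U" using independent_card_le_dim[OF U(2), of "u ` F"] u by blast
  then show False using F(3) inj by (simp add: card_image)
qed

lemma linear_pencil:
  assumes T: "Vector_Spaces.linear scale scale T" and S: "Vector_Spaces.linear scale scale S"
  shows "Vector_Spaces.linear scale scale (\<lambda>x. T x + scale t (S x))"
proof -
  interpret T: Vector_Spaces.linear scale scale T by fact
  interpret S: Vector_Spaces.linear scale scale S by fact
  show ?thesis by unfold_locales (simp_all add: T.add S.add T.scale S.scale algebra_simps)
qed

text \<open>On a complement \<open>U\<close> of the kernel of \<open>T\<close> the pencil is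
  injective for all but finitely many \<open>t\<close>; for these its rank is at least that of
  \<open>T\<close>, the member at \<open>t = 0\<close>.\<close>

lemma finite_rank_drop:
  assumes T: "Vector_Spaces.linear scale scale T" and S: "Vector_Spaces.linear scale scale S"
    and D: "subspace D" "fin_dim D"
  shows "finite {t. dim ((\<lambda>x. T x + scale t (S x)) ` D) < dim (T ` D)}"
proof -
  obtain U where U: "subspace U" "U \<subseteq> D" "inj_on T U" "dim U = dim (T ` D)"
    using rank_nullity_complement[OF T D] by metis
  have fU: "fin_dim U" using fin_dim_subset D U by blast
  have "dim (T ` D) \<le> dim ((\<lambda>x. T x + scale t (S x)) ` D)"
    if "\<not> (\<exists>u\<in>U. u \<noteq> 0 \<and> T u + scale t (S u) = 0)" for t
  proof -
    note lin = linear_pencil[OF T S, of t]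
    interpret P: Vector_Spaces.linear scale scale "\<lambda>x. T x + scale t (S x)" by (rule lin)
    have "inj_on (\<lambda>x. T x + scale t (S x)) U"
      unfolding P.inj_on_iff_eq_0[OF U(1)] using that by blast
    then have "dim ((\<lambda>x. T x + scale t (S x)) ` U) = dim U"
      using dim_image_inj[OF lin U(1) fU] by blast
    then show ?thesis
      using dim_mono_fin[OF fin_dim_image[OF lin D(2)] image_mono[OF U(2)]] U(4) by simp
  qed
  then show ?thesis
    by (intro finite_subset[OF _ finite_singular_pencil[OF T S U(1) fU U(3)]]) (auto simp: not_less[symmetric])
qed

text \<open>Here \<open>S\<close> is the member at infinity: for nonzero \<open>t\<close>, division
  by \<open>t\<close> exchanges the roles of \<open>T\<close> and \<open>S\<close> and replaces
  \<open>t\<close> by \<open>1 / t\<close>. The value \<open>t = 0\<close> is set aside as one more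
  exception.\<close>

lemma finite_rank_drop':
  assumes T: "Vector_Spaces.linear scale scale T" and S: "Vector_Spaces.linear scale scale S"
    and D: "subspace D" "fin_dim D"
  shows "finite {t. dim ((\<lambda>x. T x + scale t (S x)) ` D) < dim (S ` D)}"
proof -
  have eq: "dim ((\<lambda>x. T x + scale t (S x)) ` D) = dim ((\<lambda>x. S x + scale (inverse t) (T x)) ` D)"
    if "t \<noteq> 0" for t
  proof -
    have "(\<lambda>x. T x + scale t (S x)) ` D = scale t ` (\<lambda>x. S x + scale (inverse t) (T x)) ` D"
      using that by (simp add: image_image scale_right_distrib add.commute)
    moreover have "dim (scale t ` ((\<lambda>x. S x + scale (inverse t) (T x)) ` D)) =
        dim ((\<lambda>x. S x + scale (inverse t) (T x)) ` D)"
      using that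
      by (intro dim_image_inj linear_scale_self subspace_linear_image[OF linear_pencil] assms
          fin_dim_image[OF linear_pencil]) (simp add: inj_on_def)
    ultimately show ?thesis by simp
  qed
  have "{t. dim ((\<lambda>x. T x + scale t (S x)) ` D) < dim (S ` D)}
    \<subseteq> insert 0 (inverse ` {t. dim ((\<lambda>x. S x + scale t (T x)) ` D) < dim (S ` D)})"
  proof
    fix t assume t: "t \<in> {t. dim ((\<lambda>x. T x + scale t (S x)) ` D) < dim (S ` D)}"
    show "t \<in> insert 0 (inverse ` {t. dim ((\<lambda>x. S x + scale t (T x)) ` D) < dim (S ` D)})"
    proof (cases "t = 0")
      case False
      then show ?thesis using t eq[OF False]
        by (auto intro!: image_eqI[of _ _ "inverse t"])
    qed simp
  qed
  then show ?thesis
    using finite_subset finite_rank_drop[OF S T D] by blast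
qed

end

section \<open>Green's restriction theorem\<close>

text \<open>The polynomial \<open>p\<^sub>d(x)\<close>. For positive \<open>d\<close>, real
  arguments allow every dimension that is at least 1 to be written as a value of it, so no binomial
  expansions of integers occur.\<close>

definition forms_dim :: "nat \<Rightarrow> real \<Rightarrow> real" where
  "forms_dim d x = pochhammer x d / fact d"

lemma forms_dim_0 [simp]: "forms_dim 0 x = 1"
  by (simp add: forms_dim_def)

lemma forms_dim_Suc: "forms_dim (Suc d) x = forms_dim d x * ((x + real d) / (real d + 1))"
  by (simp add: forms_dim_def pochhammer_Suc add.commute)

lemma forms_dim_1 [simp]: "forms_dim (Suc 0) x = x"
  by (simp add: forms_dim_Suc)

text \<open>For positive integers \<open>x\<close> this sorts monomials by whether the last variable
  occurs; the identity for rising factorials extends it to real \<open>x\<close>.\<close>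

lemma forms_dim_pascal: "forms_dim (Suc d) x - forms_dim (Suc d) (x - 1) = forms_dim d x"
proof -
  have "pochhammer x (Suc d) - pochhammer (x - 1) (Suc d) = (real d + 1) * pochhammer x d"
    by (subst pochhammer_Suc, subst pochhammer_rec) (simp add: algebra_simps)
  then show ?thesis
    by (simp add: forms_dim_def diff_divide_distrib[symmetric] add.commute)
qed

lemma forms_dim_nonneg: "0 \<le> x \<Longrightarrow> 0 \<le> forms_dim d x"
  by (induction d) (simp_all add: forms_dim_Suc)

lemma forms_dim_pos: "0 < x \<Longrightarrow> 0 < forms_dim d x"
  by (simp add: forms_dim_def pochhammer_pos)

lemma forms_dim_mono: "0 \<le> x \<Longrightarrow> x \<le> y \<Longrightarrow> forms_dim d x \<le> forms_dim d y"
proof (induction d)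
  case (Suc d)
  then show ?case unfolding forms_dim_Suc
    by (intro mult_mono divide_right_mono forms_dim_nonneg) auto
qed simp

lemma forms_dim_strict_mono:
  assumes "0 \<le> x" "x < y"
  shows "forms_dim (Suc d) x < forms_dim (Suc d) y"
proof -
  have "forms_dim (Suc d) x \<le> forms_dim d y * ((x + real d) / (real d + 1))"
    unfolding forms_dim_Suc using assms by (intro mult_right_mono forms_dim_mono) auto
  also have "\<dots> < forms_dim (Suc d) y"
    unfolding forms_dim_Suc using assms
    by (intro mult_strict_left_mono forms_dim_pos divide_strict_right_mono) auto
  finally show ?thesis .
qed

lemma forms_dim_le_cancel: "0 \<le> y \<Longrightarrow> forms_dim (Suc d) x \<le> forms_dim (Suc d) y \<Longrightarrow> x \<le> y"
  using forms_dim_strict_mono[of y x d] by (meson not_le)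

lemma forms_dim_less_cancel: "0 \<le> y \<Longrightarrow> forms_dim (Suc d) x < forms_dim (Suc d) y \<Longrightarrow> x < y"
  using forms_dim_mono[of y x "Suc d"] by (meson not_le)

lemma forms_dim_at_1 [simp]: "forms_dim d 1 = 1"
  by (induction d) (simp_all add: forms_dim_Suc add.commute)

lemma forms_dim_ge_self: "1 \<le> x \<Longrightarrow> x \<le> forms_dim (Suc d) x"
proof (induction d)
  case (Suc d)
  have "1 \<le> (x + real (Suc d)) / (real (Suc d) + 1)" using Suc.prems by simp
  then have "forms_dim (Suc d) x * 1 \<le> forms_dim (Suc (Suc d)) x"
    unfolding forms_dim_Suc[of "Suc d"] using Suc.prems by (intro mult_left_mono forms_dim_nonneg) auto
  then show ?case using Suc by simp
qed simp

text \<open>The value at 1 is 1 and the value at \<open>y\<close> is at least \<open>y\<close>, so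
  the intermediate value theorem applies between them. This is how dimensions are turned into real
  arguments.\<close>

lemma forms_dim_attains:
  assumes "1 \<le> y"
  obtains x where "1 \<le> x" "forms_dim (Suc d) x = y"
proof -
  have "continuous_on {1..y} (forms_dim (Suc d))"
    unfolding forms_dim_def[abs_def] pochhammer_prod by (intro continuous_intros) simp
  then have "\<exists>x\<ge>1. x \<le> y \<and> forms_dim (Suc d) x = y"
    using assms forms_dim_ge_self[OF assms, of d] forms_dim_at_1[of "Suc d"] by (intro IVT') auto
  then show thesis using that by blast
qed

text \<open>\<open>V\<close> stands for the contractions by linear forms. Closure under pencils is
  the form in which a generic choice enters: over an infinite field some member avoids finitely many
  bad parameters.\<close>

locale commuting_operators = lin_space scale
  for scale :: "'a::field \<Rightarrow> 'b::ab_group_add \<Rightarrow> 'b" +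
  fixes V :: "('b \<Rightarrow> 'b) set"
  assumes linear_V: "T \<in> V \<Longrightarrow> Vector_Spaces.linear scale scale T"
    and commute_V: "S \<in> V \<Longrightarrow> T \<in> V \<Longrightarrow> S (T x) = T (S x)"
    and pencil_V: "S \<in> V \<Longrightarrow> T \<in> V \<Longrightarrow> (\<lambda>x. S x + scale t (T x)) \<in> V"
begin

text \<open>Dual to generation in degree 1. \<open>D\<close> plays the part of a space of elements
  of degree \<open>d\<close> and its images that of spaces of degree \<open>d - 1\<close>, hence the
  nesting to depth \<open>d\<close>.\<close>

primrec cogenerated :: "nat \<Rightarrow> 'b set \<Rightarrow> bool" where
  "cogenerated 0 D = True"
| "cogenerated (Suc d) D \<longleftrightarrow>
     (\<forall>x\<in>D. (\<forall>T\<in>V. T x = 0) \<longrightarrow> x = 0) \<and> (\<forall>T\<in>V. cogenerated d (T ` D))"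

lemma cogenerated_subset: "cogenerated d D \<Longrightarrow> E \<subseteq> D \<Longrightarrow> cogenerated d E"
proof (induction d arbitrary: D E)
  case (Suc d)
  then show ?case by simp (meson image_mono subsetD)
qed simp

lemma exists_rank_pos:
  assumes "subspace D" "fin_dim D" "cogenerated (Suc d) D" "0 < dim D"
  obtains T where "T \<in> V" "0 < dim (T ` D)"
proof -
  obtain x where x: "x \<in> D" "x \<noteq> 0" using dim_pos_nonzero assms(4) by blast
  then obtain T where T: "T \<in> V" "T x \<noteq> 0" using assms(3) by auto
  have "0 < dim (T ` D)"
    using x T fin_dim_image[OF linear_V[OF T(1)] assms(2)] by (intro dim_pos[of _ "T x"]) auto
  then show thesis using that T by blast
qed

text \<open>A continuous version of Green's hyperplane restriction theorem, in the dual formulation: the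
  inverse system \<open>D\<close> of an algebra \<open>A\<close> replaces \<open>A\<close>, kernels and images of a linear form on \<open>D\<close>
  replace \<open>A/(L)\<close> and \<open>A/(0:L)\<close>. If every rank were too small, take \<open>L'\<close> of maximal rank on \<open>D\<close>,
  then \<open>L\<close> good for \<open>L' D\<close> and \<open>L''\<close> good for \<open>K = ker L\<close>. A generic member \<open>M\<close> of the pencil
  \<open>L'' + t L'\<close> has both properties, and comparing \<open>M K\<close> with the kernel of \<open>L\<close> on \<open>M D\<close> gives a
  contradiction.\<close>

theorem green:
  assumes "infinite (UNIV :: 'a set)"
  assumes "subspace D" "fin_dim D" "cogenerated (Suc d) D" "1 \<le> x" "forms_dim (Suc d) x \<le> dim D"
  shows "\<exists>T\<in>V. forms_dim d x \<le> dim (T ` D)"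
  using assms(2-)
proof (induction d arbitrary: D x)
  case 0
  then have "0 < dim D" by simp
  then obtain T where "T \<in> V" "0 < dim (T ` D)"
    using exists_rank_pos 0 by metis
  then show ?case by (intro bexI[of _ T]) auto
next
  case (Suc d)
  note IH = Suc.IH
  show ?case using Suc.prems
  \<comment> \<open>The inner induction on the dimension serves the kernel \<open>?K\<close>, which
    has the same depth as \<open>D\<close> but smaller dimension; the outer one serves the image of
    \<open>D\<close> under \<open>L'\<close>.\<close>
  proof (induction "dim D" arbitrary: D x rule: less_induct)
    case less
    note D = less.prems(1,2)
    show ?case
    proof (rule ccontr)
      assume "\<not> ?thesis"
      then have small: "dim (T ` D) < forms_dim (Suc d) x" if "T \<in> V" for T using that by force
      have dD: "0 < dim D"
        using less.prems(4,5) forms_dim_pos[of x "Suc (Suc d)"] by simp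
      obtain T0 where T0: "T0 \<in> V" "0 < dim (T0 ` D)"
        using exists_rank_pos[OF D less.prems(3) dD] by blast
      have bound: "dim (T ` D) \<le> dim D" if "T \<in> V" for T
        using rank_nullity[OF linear_V[OF that] D] by simp
      obtain L' where L': "L' \<in> V" and max: "\<And>T. T \<in> V \<Longrightarrow> dim (T ` D) \<le> dim (L' ` D)"
      proof -
        have "\<exists>T. T \<in> V \<and> (\<forall>S. S \<in> V \<longrightarrow> dim (S ` D) \<le> dim (T ` D))"
          by (rule ex_has_greatest_nat[of "\<lambda>T. T \<in> V" T0 _ "Suc (dim D)"]) (auto simp: T0 less_Suc_eq_le bound)
        then show thesis using that by blast
      qed
      have D': "subspace (L' ` D)" "fin_dim (L' ` D)"
        using D linear_V[OF L'] by (auto intro: subspace_linear_image fin_dim_image)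
      have "1 \<le> real (dim (L' ` D))" using max[OF T0(1)] T0(2) by simp
      then obtain z where z: "1 \<le> z" "forms_dim (Suc d) z = dim (L' ` D)"
        by (rule forms_dim_attains)
      have "z < x" using forms_dim_less_cancel[of x d z] small[OF L'] z less.prems(4) by simp
      have "cogenerated (Suc d) (L' ` D)" using less.prems(3) L' by simp
      then obtain L where L: "L \<in> V" "forms_dim d z \<le> dim (L ` L' ` D)"
        using IH[OF D' _ z(1)] z(2) by auto
      interpret L: Vector_Spaces.linear scale scale L by (rule linear_V[OF L(1)])
      interpret L': Vector_Spaces.linear scale scale L' by (rule linear_V[OF L'])
      \<comment> \<open>\<open>L\<close> does not vanish on \<open>D\<close>, so its kernel is a
        proper subspace and the inner induction hypothesis will apply to it.\<close>
      have "0 < dim (L ` L' ` D)"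
        using L(2) forms_dim_pos[of z d] z(1) by simp
      then obtain v where v: "v \<in> D" "L (L' v) \<noteq> 0" using dim_pos_nonzero by blast
      then have "L v \<noteq> 0" using commute_V[OF L(1) L', of v] by auto
      then have dLD: "0 < dim (L ` D)"
        using v(1) fin_dim_image[OF linear_V[OF L(1)] D(2)] by (intro dim_pos[of _ "L v"]) auto
      let ?K = "{v \<in> D. L v = 0}"
      have K: "subspace ?K" "fin_dim ?K" "cogenerated (Suc (Suc d)) ?K"
        using subspace_ker[OF linear_V[OF L(1)] D(1)] fin_dim_subset[OF D(2), of ?K]
          cogenerated_subset[OF less.prems(3), of ?K] by auto
      have rn: "dim D = dim (L ` D) + dim ?K" using rank_nullity[OF linear_V[OF L(1)] D] .
      \<comment> \<open>The rank of \<open>L\<close> is below \<open>forms_dim (Suc d) x\<close>, so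
        by Pascal's identity what remains for the kernel exceeds the value at
        \<open>x - 1\<close>.\<close>
      have dK: "forms_dim (Suc (Suc d)) (x - 1) < dim ?K"
        using rn less.prems(5) small[OF L(1)] forms_dim_pascal[of "Suc d" x] by linarith
      then have "1 \<le> real (dim ?K)"
        using forms_dim_nonneg[of "x - 1" "Suc (Suc d)"] less.prems(4) by simp
      then obtain y where y: "1 \<le> y" "forms_dim (Suc (Suc d)) y = dim ?K"
        by (rule forms_dim_attains)
      have xy: "x - 1 < y" using dK forms_dim_less_cancel[of y "Suc d" "x - 1"] y by simp
      obtain L'' where L'': "L'' \<in> V" "forms_dim (Suc d) y \<le> dim (L'' ` ?K)"
        using less.hyps[OF _ K y(1)] y(2) rn dLD by auto
      interpret L'': Vector_Spaces.linear scale scale L'' by (rule linear_V[OF L''(1)])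
      have lin: "Vector_Spaces.linear scale scale (\<lambda>v. L (T v))" if "T \<in> V" for T
      proof -
        interpret T: Vector_Spaces.linear scale scale T by (rule linear_V[OF that])
        show ?thesis by unfold_locales (simp_all add: T.add L.add T.scale L.scale)
      qed
      let ?P = "\<lambda>t v. L'' v + scale t (L' v)"
      \<comment> \<open>Parameters at which the pencil has smaller rank on \<open>D\<close> than
        \<open>L'\<close>, smaller rank after \<open>L\<close> on \<open>D\<close> than
        \<open>L'\<close>, or smaller rank on \<open>?K\<close> than \<open>L''\<close>. In the
        first two the reference is the member at infinity, in the third the one at
        \<open>t = 0\<close>.\<close>
      let ?bad = "{t. dim (?P t ` D) < dim (L' ` D)}
        \<union> {t. dim ((\<lambda>v. L (L'' v) + scale t (L (L' v))) ` D) < dim ((\<lambda>v. L (L' v)) ` D)}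
        \<union> {t. dim (?P t ` ?K) < dim (L'' ` ?K)}"
      have "finite ?bad"
        unfolding finite_Un
        using finite_rank_drop'[OF linear_V[OF L''(1)] linear_V[OF L'] D]
          finite_rank_drop'[OF lin[OF L''(1)] lin[OF L'] D]
          finite_rank_drop[OF linear_V[OF L''(1)] linear_V[OF L'] K(1,2)] by simp
      then obtain t where t: "t \<notin> ?bad" by (rule exE[OF ex_new_if_finite[OF assms(1)]])
      let ?L = "?P t"
      have LV: "?L \<in> V" by (rule pencil_V[OF L''(1) L'])
      have DL: "subspace (?L ` D)" "fin_dim (?L ` D)"
        using D linear_V[OF LV] by (auto intro: subspace_linear_image fin_dim_image)
      have "(\<lambda>v. L (L'' v) + scale t (L (L' v))) ` D = L ` ?L ` D"
        by (simp add: image_image L.add L.scale)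
      then have 1: "forms_dim d z \<le> dim (L ` ?L ` D)" using t L(2) by (simp add: image_image not_less)
      \<comment> \<open>Genericity gives one inequality, the maximal rank of \<open>L'\<close> the
        other.\<close>
      have 2: "dim (?L ` D) = dim (L' ` D)" using t max[OF LV] by (simp add: not_less)
      have 3: "forms_dim (Suc d) y \<le> dim (?L ` ?K)" using t L''(2) by (simp add: not_less)
      have "?L ` ?K \<subseteq> {w \<in> ?L ` D. L w = 0}"
      proof
        fix w assume "w \<in> ?L ` ?K"
        then obtain v where v: "v \<in> D" "L v = 0" "w = ?L v" by blast
        have "L w = ?L (L v)" using commute_V[OF L(1) LV, of v] v(3) by simp
        also have "\<dots> = 0" using v(2) by simp
        finally show "w \<in> {w \<in> ?L ` D. L w = 0}" using v by blast
      qed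
      then have 4: "dim (?L ` ?K) \<le> dim {w \<in> ?L ` D. L w = 0}"
        using DL(2) by (intro dim_mono_fin fin_dim_subset[OF DL(2)]) auto
      have "dim (?L ` D) = dim (L ` ?L ` D) + dim {w \<in> ?L ` D. L w = 0}"
        using rank_nullity[OF linear_V[OF L(1)] DL] .
      \<comment> \<open>The chain ends in \<open>y \<le> z - 1 < x - 1 < y\<close>.\<close>
      then have "forms_dim (Suc d) y \<le> forms_dim (Suc d) z - forms_dim d z"
        using 1 2 3 4 z(2) by linarith
      also have "\<dots> = forms_dim (Suc d) (z - 1)" using forms_dim_pascal[of d z] by simp
      finally have "y \<le> z - 1" using forms_dim_le_cancel z(1) by simp
      then show False using xy \<open>z < x\<close> by simp
    qed
  qed
qed

end

section \<open>Monomials and the contraction action\<close>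

abbreviation (input) "keys \<equiv> Poly_Mapping.keys"
abbreviation (input) "lookup \<equiv> Poly_Mapping.lookup"

abbreviation (input) X :: "nat \<Rightarrow> nat \<Rightarrow>\<^sub>0 nat" where
  "X j \<equiv> Poly_Mapping.single j 1"

definition monomials :: "nat \<Rightarrow> nat \<Rightarrow> (nat \<Rightarrow>\<^sub>0 nat) set" where
  "monomials r d = {m. keys m \<subseteq> {..<r} \<and> mon_deg m = d}"

lemma mon_deg_superset: "finite A \<Longrightarrow> keys m \<subseteq> A \<Longrightarrow> mon_deg m = (\<Sum>j\<in>A. lookup m j)"
  unfolding mon_deg_def by (rule sum.mono_neutral_left) (auto simp: in_keys_iff)

lemma keys_add_nat: "keys (m + n) = keys m \<union> keys (n :: 'a \<Rightarrow>\<^sub>0 nat)"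
  by (auto simp: in_keys_iff lookup_add)

lemma mon_deg_add: "mon_deg (m + n) = mon_deg m + mon_deg n"
  by (simp add: mon_deg_superset[of "keys m \<union> keys n"] keys_add_nat lookup_add sum.distrib)

lemma mon_deg_single [simp]: "mon_deg (Poly_Mapping.single j k) = k"
  by (cases "k = 0") (simp_all add: mon_deg_def)

lemma mon_deg_0 [simp]: "mon_deg 0 = 0"
  by (simp add: mon_deg_def)

lemma mon_deg_eq_0_iff: "mon_deg m = 0 \<longleftrightarrow> m = 0"
  by (auto simp: mon_deg_def in_keys_iff poly_mapping_eq_iff fun_eq_iff)

lemma monomials_addD: "m + n \<in> monomials r d \<Longrightarrow> m \<in> monomials r (mon_deg m) \<and> n \<in> monomials r (mon_deg n) \<and> mon_deg m + mon_deg n = d"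
  by (auto simp: monomials_def keys_add_nat mon_deg_add)

lemma monomials_add: "m \<in> monomials r c \<Longrightarrow> n \<in> monomials r d \<Longrightarrow> m + n \<in> monomials r (c + d)"
  by (auto simp: monomials_def keys_add_nat mon_deg_add)

lemma X_monomials: "j < r \<Longrightarrow> X j \<in> monomials r (Suc 0)"
  by (simp add: monomials_def)

lemma monomials_0 [simp]: "monomials r 0 = {0}"
  by (auto simp: monomials_def mon_deg_eq_0_iff)

lemma split_variable:
  assumes "j \<in> keys m"
  obtains m' where "m = X j + m'"
proof
  show "m = X j + (m - X j)"
    using assms by (intro poly_mapping_eqI) (auto simp: lookup_add lookup_minus lookup_single when_def in_keys_iff)
qed

lemma monomials_SucE:
  assumes "m \<in> monomials r (Suc d)"
  obtains j m' where "j < r" "m' \<in> monomials r d" "m = X j + m'"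
proof -
  have "m \<noteq> 0" using assms by (auto simp: monomials_def)
  then obtain j where j: "j \<in> keys m" by fastforce
  then obtain m' where m': "m = X j + m'" by (rule split_variable)
  have "j < r" "m' \<in> monomials r d" using assms j unfolding m' by (auto simp: monomials_def keys_add_nat mon_deg_add)
  then show thesis using that m' by blast
qed

lemma finite_monomials [simp]: "finite (monomials r d)"
proof (induction d)
  case (Suc d)
  have "monomials r (Suc d) \<subseteq> (\<lambda>(j, m). X j + m) ` ({..<r} \<times> monomials r d)"
  proof
    fix m assume "m \<in> monomials r (Suc d)"
    then obtain j m' where "j < r" "m' \<in> monomials r d" "m = X j + m'" by (rule monomials_SucE)
    then show "m \<in> (\<lambda>(j, m). X j + m) ` ({..<r} \<times> monomials r d)" by (intro image_eqI[of _ _ "(j, m')"]) auto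
  qed
  then show ?case by (rule finite_subset) (simp add: Suc)
qed simp

lemma monomials_Suc_Suc:
  "monomials (Suc r) (Suc d) = monomials r (Suc d) \<union> (+) (X r) ` monomials (Suc r) d"
proof (intro equalityI subsetI)
  fix m assume m: "m \<in> monomials (Suc r) (Suc d)"
  show "m \<in> monomials r (Suc d) \<union> (+) (X r) ` monomials (Suc r) d"
  proof (cases "r \<in> keys m")
    case True
    then obtain m' where m': "m = X r + m'" by (rule split_variable)
    with m have "m' \<in> monomials (Suc r) d" by (auto simp: monomials_def keys_add_nat mon_deg_add)
    with m' show ?thesis by blast
  next
    case False
    with m show ?thesis by (force simp: monomials_def less_Suc_eq)
  qed
next
  fix m assume "m \<in> monomials r (Suc d) \<union> (+) (X r) ` monomials (Suc r) d"
  then show "m \<in> monomials (Suc r) (Suc d)"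
    using monomials_add[OF X_monomials[of r "Suc r"]] by (auto simp: monomials_def)
qed

text \<open>Sorting by divisibility by the last variable gives the recursion of
  \<open>forms_dim_pascal\<close>.\<close>

lemma card_monomials: "real (card (monomials r d)) = forms_dim d (real r)"
proof (induction r arbitrary: d)
  case 0
  have "monomials 0 d = (if d = 0 then {0} else {})"
    by (auto simp: monomials_def)
  then show ?case by (simp add: forms_dim_def pochhammer_0_left)
next
  case (Suc r)
  note IHr = Suc
  show ?case
  proof (induction d)
    case (Suc d)
    have "monomials r (Suc d) \<inter> (+) (X r) ` monomials (Suc r) d = {}"
      by (auto simp: monomials_def keys_add_nat)
    then have "card (monomials (Suc r) (Suc d)) = card (monomials r (Suc d)) + card (monomials (Suc r) d)"
      unfolding monomials_Suc_Suc by (subst card_Un_disjoint) (auto simp: card_image)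
    then show ?case using Suc IHr[of "Suc d"] forms_dim_pascal[of d "real (Suc r)"] by simp
  qed simp
qed

lemma hom_part_iff: "p \<in> hom_part r d \<longleftrightarrow> keys p \<subseteq> monomials r d"
  by (auto simp: hom_part_def poly_ring_def monomials_def)

section \<open>Functions on monomials and polynomials as vector spaces\<close>

lemma sum_fun_apply: "(\<Sum>a\<in>A. f a) x = (\<Sum>a\<in>A. f a x)"
  for f :: "'a \<Rightarrow> 'b \<Rightarrow> 'c::comm_monoid_add"
  by (induction A rule: infinite_finite_induct) auto

definition fun_scale :: "'k::field \<Rightarrow> ('a \<Rightarrow> 'k) \<Rightarrow> 'a \<Rightarrow> 'k" where
  "fun_scale c f = (\<lambda>x. c * f x)"

interpretation fn: lin_space fun_scale
  by unfold_locales (auto simp: fun_scale_def fun_eq_iff algebra_simps)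

lemma const_add: "const (a + b) = const a + const b"
  by (simp add: const_def single_add)

lemma const_mult: "const (a * b) = const a * const b"
  by (simp add: const_def mult_single)

lemma const_1 [simp]: "const 1 = 1"
  by (simp add: const_def)

lemma const_0 [simp]: "const 0 = 0"
  by (simp add: const_def)

interpretation mp: lin_space "\<lambda>c p. const c * p :: 'k::field mpoly"
  by unfold_locales (auto simp: const_add const_mult algebra_simps)

lemma mpoly_eq_sum: "p = (\<Sum>m\<in>keys p. Poly_Mapping.single m (lookup p m))"
  by (intro poly_mapping_eqI) (simp add: lookup_sum lookup_single when_def in_keys_iff)

lemma lookup_single_times: "lookup (Poly_Mapping.single a c * p) (a + b) = c * lookup p b"
  for a b :: "nat \<Rightarrow>\<^sub>0 nat" and p :: "'k::field mpoly"
proof -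
  have "Poly_Mapping.single a c * p = Poly_Mapping.single a c * (\<Sum>m\<in>keys p. Poly_Mapping.single m (lookup p m))"
    by (simp flip: mpoly_eq_sum)
  also have "\<dots> = (\<Sum>m\<in>keys p. Poly_Mapping.single (a + m) (c * lookup p m))"
    by (simp only: sum_distrib_left mult_single)
  finally have "lookup (Poly_Mapping.single a c * p) (a + b) =
      (\<Sum>m\<in>keys p. if m = b then c * lookup p m else 0)"
    by (simp only: lookup_sum lookup_single when_def add_left_cancel)
  then show ?thesis by (simp add: in_keys_iff)
qed

lemma lookup_const_times [simp]: "lookup (const c * p) m = c * lookup p m"
  using lookup_single_times[of 0 c p m] by (simp add: const_def)

text \<open>Contraction: a function on monomials is read as a linear functional on polynomials, and
  \<open>act p \<phi>\<close> is the functional sending \<open>q\<close> to the value of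
  \<open>\<phi>\<close> on \<open>p q\<close>. No factorials enter, so the characteristic of the
  field does not matter.\<close>

definition act :: "'k::field mpoly \<Rightarrow> ((nat \<Rightarrow>\<^sub>0 nat) \<Rightarrow> 'k) \<Rightarrow> (nat \<Rightarrow>\<^sub>0 nat) \<Rightarrow> 'k" where
  "act p \<phi> = (\<lambda>m. \<Sum>a\<in>keys p. lookup p a * \<phi> (a + m))"

lemma act_superset: "finite A \<Longrightarrow> keys p \<subseteq> A \<Longrightarrow> act p \<phi> m = (\<Sum>a\<in>A. lookup p a * \<phi> (a + m))"
  unfolding act_def by (rule sum.mono_neutral_left) (auto simp: in_keys_iff)

lemma act_add: "act (p + q) \<phi> = act p \<phi> + act q \<phi>"
proof
  fix m show "act (p + q) \<phi> m = (act p \<phi> + act q \<phi>) m"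
    using keys_add[of p q]
    by (simp add: act_superset[of "keys p \<union> keys q"] lookup_add sum.distrib algebra_simps)
qed

lemma act_const_times: "act (const c * p) \<phi> = fun_scale c (act p \<phi>)"
proof
  fix m show "act (const c * p) \<phi> m = fun_scale c (act p \<phi>) m"
  proof (subst act_superset[of "keys p"])
    show "keys (const c * p) \<subseteq> keys p" by (auto simp: in_keys_iff)
  qed (simp_all add: act_def fun_scale_def sum_distrib_left mult.assoc)
qed

lemma linear_act: "Vector_Spaces.linear (\<lambda>c p. const c * p) fun_scale (\<lambda>p. act p \<phi>)"
  by unfold_locales (simp_all add: act_add act_const_times)

interpretation act: Vector_Spaces.linear "\<lambda>c p. const c * p" fun_scale "\<lambda>p. act p \<phi>" for \<phi> :: "(nat \<Rightarrow>\<^sub>0 nat) \<Rightarrow> 'k::field"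
  by (rule linear_act)

lemma act_single: "act (Poly_Mapping.single a c) \<phi> m = c * \<phi> (a + m)"
  by (simp add: act_def)

lemma act_mult: "act (q * p) \<phi> = act q (act p \<phi>)"
proof
  fix m
  have "q * p = (\<Sum>a\<in>keys q. \<Sum>b\<in>keys p. Poly_Mapping.single (a + b) (lookup q a * lookup p b))"
  proof -
    have "q * p = (\<Sum>a\<in>keys q. Poly_Mapping.single a (lookup q a)) * (\<Sum>a\<in>keys p. Poly_Mapping.single a (lookup p a))"
      by (simp flip: mpoly_eq_sum)
    then show ?thesis by (simp only: sum_product mult_single)
  qed
  then have "act (q * p) \<phi> m = (\<Sum>a\<in>keys q. \<Sum>b\<in>keys p. lookup q a * lookup p b * \<phi> (a + b + m))"
    by (simp only: act.sum sum_fun_apply act_single)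
  then show "act (q * p) \<phi> m = act q (act p \<phi>) m"
    by (simp add: act_def sum_distrib_left ac_simps)
qed

section \<open>Relative dimensions\<close>

lemma subspace_hom_part: "mp.subspace (hom_part r d)"
proof (rule mp.subspaceI)
  fix p q :: "'a mpoly" and c
  assume p: "p \<in> hom_part r d"
  show "const c * p \<in> hom_part r d" using p by (auto simp: hom_part_iff in_keys_iff)
  assume "q \<in> hom_part r d"
  then show "p + q \<in> hom_part r d" using p keys_add[of p q] by (auto simp: hom_part_iff)
qed (simp add: hom_part_iff)

lemma hom_part_mult: "p \<in> hom_part r c \<Longrightarrow> q \<in> hom_part r d \<Longrightarrow> p * q \<in> hom_part r (c + d)"
  using keys_mult[of p q] by (fastforce simp: hom_part_iff intro: monomials_add)

lemma single_hom_part: "m \<in> monomials r d \<Longrightarrow> Poly_Mapping.single m c \<in> hom_part r d"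
  by (simp add: hom_part_iff)

lemma hom_part_subset_poly_ring: "hom_part r d \<subseteq> poly_ring r"
  by (auto simp: hom_part_def)

lemma const_poly_ring: "const c \<in> poly_ring r"
  by (simp add: const_def poly_ring_def)

lemma subspace_ideal: "is_ideal r I \<Longrightarrow> mp.subspace I"
  by (rule mp.subspaceI) (auto simp: is_ideal_def const_poly_ring)

text \<open>A relation among the images comes from a combination in \<open>V\<close> killed by
  \<open>\<tau>\<close>, hence lying in \<open>W\<close>. As the kernel is only required to be
  inside \<open>W\<close>, the lemma also applies to truncations, whose kernel may be
  smaller.\<close>

lemma indep_mod_image:
  assumes \<tau>: "Vector_Spaces.linear (\<lambda>c p. const c * p) fun_scale \<tau>"
    and V: "mp.subspace V" "\<And>p. p \<in> V \<Longrightarrow> \<tau> p = 0 \<Longrightarrow> p \<in> W"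
    and B: "finite B" "B \<subseteq> V" "indep_mod W B"
  shows "inj_on \<tau> B" "fn.independent (\<tau> ` B)"
proof -
  interpret \<tau>: Vector_Spaces.linear "\<lambda>c p. const c * p" fun_scale \<tau> by (rule \<tau>)
  have ind: "a t = 0" if "(\<Sum>b\<in>B. fun_scale (a b) (\<tau> b)) = 0" "t \<in> B" for a t
  proof -
    have "\<tau> (\<Sum>b\<in>B. const (a b) * b) = 0" using that(1) by (simp add: \<tau>.sum \<tau>.scale)
    moreover have "(\<Sum>b\<in>B. const (a b) * b) \<in> V"
      using B(2) by (intro mp.subspace_sum mp.subspace_scale V) auto
    ultimately show ?thesis using V(2) B(3) that(2) by (auto simp: indep_mod_def)
  qed
  show "inj_on \<tau> B" by (rule fn.independent_familyI(1)[OF B(1)]) (rule ind)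
  show "fn.independent (\<tau> ` B)" by (rule fn.independent_familyI(2)[OF B(1)]) (rule ind)
qed

lemma indep_mod_card_le:
  assumes "Vector_Spaces.linear (\<lambda>c p. const c * p) fun_scale \<tau>"
    and "mp.subspace V" "\<And>p. p \<in> V \<Longrightarrow> \<tau> p = 0 \<Longrightarrow> p \<in> W" "fn.fin_dim (\<tau> ` V)"
    and "finite B" "B \<subseteq> V" "indep_mod W B"
  shows "card B \<le> fn.dim (\<tau> ` V)"
proof -
  have "inj_on \<tau> B" "fn.independent (\<tau> ` B)"
    by (rule indep_mod_image[OF assms(1-3,5-7)]; assumption)+
  then show ?thesis
    using fn.independent_card_le_dim[OF assms(4) image_mono[OF assms(6)]] by (simp add: card_image)
qed

text \<open>Lifting a basis of the image attains the supremum that defines \<open>reldim\<close>.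
  All relative dimensions are thereby turned into dimensions of spaces of functions.\<close>

lemma reldim_eq_dim_image:
  assumes \<tau>: "Vector_Spaces.linear (\<lambda>c p. const c * p) fun_scale \<tau>"
    and V: "mp.subspace V" "\<And>p. p \<in> V \<Longrightarrow> \<tau> p = 0 \<longleftrightarrow> p \<in> W" "fn.fin_dim (\<tau> ` V)"
  shows "reldim V W = fn.dim (\<tau> ` V)"
  unfolding reldim_def
proof (rule cSup_eq_maximum)
  interpret \<tau>: Vector_Spaces.linear "\<lambda>c p. const c * p" fun_scale \<tau> by (rule \<tau>)
  obtain C where C: "finite C" "C \<subseteq> \<tau> ` V" "fn.independent C" "card C = fn.dim (\<tau> ` V)"
    by (rule fn.fin_dim_basis[OF \<tau>.subspace_image[OF V(1)] V(3)])
  then have "\<forall>y\<in>C. \<exists>p. p \<in> V \<and> \<tau> p = y" by blast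
  then obtain g where g: "\<And>y. y \<in> C \<Longrightarrow> g y \<in> V \<and> \<tau> (g y) = y" by metis
  have inj: "inj_on g C" by (metis g inj_onI)
  have "indep_mod W (g ` C)"
    unfolding indep_mod_def
  proof (intro allI impI ballI)
    fix c b assume W: "(\<Sum>b\<in>g ` C. const (c b) * b) \<in> W" and b: "b \<in> g ` C"
    have "(\<Sum>b\<in>g ` C. const (c b) * b) \<in> V"
      using g by (intro mp.subspace_sum mp.subspace_scale V) auto
    then have "0 = \<tau> (\<Sum>b\<in>g ` C. const (c b) * b)" using V(2) W by simp
    also have "\<dots> = (\<Sum>y\<in>C. fun_scale (c (g y)) y)"
      by (simp add: \<tau>.sum \<tau>.scale sum.reindex[OF inj] g)
    finally have "c (g y) = 0" if "y \<in> C" for y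
      using fn.independentD[OF C(3,1) subset_refl, of "\<lambda>y. c (g y)" y] that by simp
    then show "c b = 0" using b by blast
  qed
  then show "fn.dim (\<tau> ` V) \<in> {card B |B. finite B \<and> B \<subseteq> V \<and> indep_mod W B}"
    using C(1,4) g by (auto intro!: exI[of _ "g ` C"] simp: card_image[OF inj])
next
  fix n assume "n \<in> {card B |B. finite B \<and> B \<subseteq> V \<and> indep_mod W B}"
  then show "n \<le> fn.dim (\<tau> ` V)" using indep_mod_card_le[OF \<tau> V(1) _ V(3)] V(2) by blast
qed

section \<open>Finite supports and truncation\<close>

definition supported :: "'a set \<Rightarrow> ('a \<Rightarrow> 'k::field) set" where
  "supported A = {\<phi>. \<forall>m. \<phi> m \<noteq> 0 \<longrightarrow> m \<in> A}"

definition delta :: "'a \<Rightarrow> 'a \<Rightarrow> 'k::field" where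
  "delta a = (\<lambda>x. if x = a then 1 else 0)"

lemma supported_subset_span:
  assumes "finite A"
  shows "(supported A :: ('a \<Rightarrow> 'k::field) set) \<subseteq> fn.span (delta ` A)"
proof
  fix \<phi> :: "'a \<Rightarrow> 'k" assume \<phi>: "\<phi> \<in> supported A"
  have "\<phi> = (\<Sum>a\<in>A. fun_scale (\<phi> a) (delta a))"
  proof
    fix x
    have "(\<Sum>a\<in>A. fun_scale (\<phi> a) (delta a)) x = (\<Sum>a\<in>A. if x = a then \<phi> a else 0)"
      by (simp add: sum_fun_apply fun_scale_def delta_def if_distrib cong: if_cong)
    also have "\<dots> = \<phi> x" using assms \<phi> by (auto simp: supported_def)
    finally show "\<phi> x = (\<Sum>a\<in>A. fun_scale (\<phi> a) (delta a)) x" by simp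
  qed
  moreover have "(\<Sum>a\<in>A. fun_scale (\<phi> a) (delta a)) \<in> fn.span (delta ` A)"
    by (intro fn.span_sum fn.span_scale fn.span_base) auto
  ultimately show "\<phi> \<in> fn.span (delta ` A)" by simp
qed

lemma fin_dim_supported: "finite A \<Longrightarrow> fn.fin_dim (supported A)"
  using supported_subset_span unfolding fn.fin_dim_def by blast

definition trunc :: "'a set \<Rightarrow> ('a \<Rightarrow>\<^sub>0 'k::field) \<Rightarrow> 'a \<Rightarrow> 'k" where
  "trunc A p = (\<lambda>m. if m \<in> A then lookup p m else 0)"

lemma linear_trunc: "Vector_Spaces.linear (\<lambda>c p. const c * p) fun_scale (trunc A)"
  by unfold_locales (auto simp: trunc_def fun_scale_def fun_eq_iff lookup_add)

lemma trunc_supported: "trunc A p \<in> supported A"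
  by (simp add: trunc_def supported_def)

text \<open>Independence modulo \<open>W\<close> is already visible in the finitely many
  coefficients at \<open>A\<close>. Boundedness is what makes the supremum of natural numbers in
  \<open>reldim\<close> an upper bound.\<close>

lemma bounded_indep_mod:
  assumes "mp.subspace V" "finite A" "\<And>p. p \<in> V \<Longrightarrow> keys p \<inter> A = {} \<Longrightarrow> p \<in> W"
  shows "bdd_above {card B |B. finite B \<and> B \<subseteq> V \<and> indep_mod W B}"
proof -
  have fd: "fn.fin_dim (trunc A ` V)"
    by (rule fn.fin_dim_subset[OF fin_dim_supported[OF assms(2)]]) (auto intro: trunc_supported)
  have ker: "p \<in> W" if "p \<in> V" "trunc A p = 0" for p
  proof (rule assms(3)[OF that(1)])
    have "lookup p m = 0" if "m \<in> A" for m
      using fun_cong[OF \<open>trunc A p = 0\<close>, of m] that by (simp add: trunc_def)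
    then show "keys p \<inter> A = {}" by (auto simp: in_keys_iff)
  qed
  have "card B \<le> fn.dim (trunc A ` V)" if "finite B" "B \<subseteq> V" "indep_mod W B" for B
    by (rule indep_mod_card_le[OF linear_trunc assms(1) ker fd that])
  then show ?thesis by (intro bdd_aboveI) blast
qed

lemma card_le_reldim:
  assumes "mp.subspace V" "finite A" "\<And>p. p \<in> V \<Longrightarrow> keys p \<inter> A = {} \<Longrightarrow> p \<in> W"
    and "finite B" "B \<subseteq> V" "indep_mod W B"
  shows "card B \<le> reldim V W"
  unfolding reldim_def using assms by (intro cSup_upper bounded_indep_mod) auto

lemma indep_mod_single:
  assumes "mp.subspace W" "p \<notin> W"
  shows "indep_mod W {p}"
  unfolding indep_mod_def
proof (intro allI impI ballI)
  fix c b assume "(\<Sum>b\<in>{p}. const (c b) * b) \<in> W" "b \<in> {p}"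
  then have "const (inverse (c p)) * (const (c p) * p) \<in> W"
    using mp.subspace_scale[OF assms(1), of "const (c p) * p" "inverse (c p)"] by simp
  then have "const (inverse (c p) * c p) * p \<in> W" by (simp only: mp.scale_scale)
  then show "c b = 0" using assms(2) \<open>b \<in> {p}\<close> by (cases "c p = 0") simp_all
qed

lemma reldim_eq_0:
  assumes "mp.subspace V" "V \<subseteq> W"
  shows "reldim V W = 0"
proof -
  let ?z = "(\<lambda>p. 0) :: 'a mpoly \<Rightarrow> nat \<Rightarrow> 'a"
  have sub: "?z ` V \<subseteq> fn.span {}" by auto
  then have "fn.fin_dim (?z ` V)" unfolding fn.fin_dim_def by blast
  moreover have "Vector_Spaces.linear (\<lambda>c p. const c * p) fun_scale ?z"
    by unfold_locales (auto simp: fun_scale_def)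
  ultimately have "reldim V W = fn.dim (?z ` V)"
    using reldim_eq_dim_image[of ?z V W] assms by blast
  also have "\<dots> = 0" using fn.dim_le_card[OF sub] by simp
  finally show ?thesis .
qed

section \<open>Variables, the socle and homogeneous components\<close>

lemma Var_mult_commute: "Var j * (const c * p) = const c * (Var j * p)"
  by (simp add: algebra_simps)

lemma Var_hom_part: "j < r \<Longrightarrow> Var j \<in> hom_part r (Suc 0)"
  unfolding Var_def by (intro single_hom_part X_monomials)

lemma Var_times_single: "Var j * Poly_Mapping.single m c = Poly_Mapping.single (X j + m) c"
  by (simp add: Var_def mult_single)

lemma subspace_socle:
  assumes "is_ideal r I"
  shows "mp.subspace (socle_pre r I)"
proof (rule mp.subspaceI)
  note sI = subspace_ideal[OF assms]
  show "0 \<in> socle_pre r I" using mp.subspace_0[OF sI] by (simp add: socle_pre_def poly_ring_def)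
  fix p q c assume p: "p \<in> socle_pre r I"
  show "const c * p \<in> socle_pre r I"
    using p mp.subspace_scale[OF sI] unfolding socle_pre_def
    by (auto simp: poly_ring_def in_keys_iff Var_mult_commute)
  assume "q \<in> socle_pre r I"
  then show "p + q \<in> socle_pre r I"
    using p mp.subspace_add[OF sI] keys_add[of p q]
    by (simp add: socle_pre_def poly_ring_def distrib_left) blast
qed

lemma hcomp_hom: "p \<in> hom_part r c \<Longrightarrow> hcomp d p = (if c = d then p else 0)"
  by (intro poly_mapping_eqI) (auto simp: hcomp_def lookup_mapp hom_part_def when_def in_keys_iff)

lemma hcomp_diff: "hcomp d (p - q) = hcomp d p - hcomp d q"
  by (intro poly_mapping_eqI) (auto simp: hcomp_def lookup_mapp when_def in_keys_iff lookup_minus)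

section \<open>Macaulay duality\<close>

text \<open>The socle is a line, spanned by the class of a form \<open>s\<close> of degree
  \<open>e\<close>, and \<open>\<Phi>\<close> is the coordinate along \<open>s\<close>. A form
  outside \<open>I\<close> has a monomial multiple outside \<open>I\<close> of largest degree; that
  multiple lies in the socle, hence in degree \<open>e\<close>, where \<open>\<Phi>\<close> detects
  it.\<close>

lemma AG_dual_generator:
  fixes I :: "'k::field mpoly set"
  assumes "AG_algebra r e I"
  obtains \<Phi> where "\<Phi> \<in> supported (monomials r e)"
    "\<And>d p. p \<in> hom_part r d \<Longrightarrow> p \<in> I \<longleftrightarrow> act p \<Phi> = 0"
proof -
  have hom: "\<And>p d. p \<in> I \<Longrightarrow> hcomp d p \<in> I" and ideal: "is_ideal r I"
    and soc1: "reldim (socle_pre r I) I = 1" and he: "hilb r I e \<noteq> 0" and he': "\<And>d. d > e \<Longrightarrow> hilb r I d = 0"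
    using assms by (auto simp: AG_algebra_def homogeneous_ideal_def)
  obtain N where N: "\<And>d. d \<ge> N \<Longrightarrow> hom_part r d \<subseteq> I"
    using assms unfolding AG_algebra_def is_artinian_def by blast
  note sI = subspace_ideal[OF ideal]
  have mult: "q * p \<in> I" if "p \<in> I" "q \<in> poly_ring r" for p q
    using ideal that by (auto simp: is_ideal_def)
  \<comment> \<open>By artinianity a polynomial with no monomial of degree below \<open>N\<close>
    lies in \<open>I\<close>, so finitely many coefficients decide independence modulo
    \<open>I\<close>.\<close>
  define A where "A = (\<Union>d<N. monomials r d)"
  have tail: "p \<in> I" if "p \<in> poly_ring r" "keys p \<inter> A = {}" for p
  proof -
    have "Poly_Mapping.single m (lookup p m) \<in> I" if "m \<in> keys p" for m
    proof -
      have "m \<in> monomials r (mon_deg m)"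
        using that \<open>p \<in> poly_ring r\<close> by (auto simp: poly_ring_def monomials_def)
      moreover from this have "mon_deg m \<ge> N"
        using that \<open>keys p \<inter> A = {}\<close> by (force simp: A_def not_less)
      ultimately show ?thesis using N single_hom_part by blast
    qed
    then have "(\<Sum>m\<in>keys p. Poly_Mapping.single m (lookup p m)) \<in> I"
      by (rule mp.subspace_sum[OF sI])
    then show ?thesis by (simp flip: mpoly_eq_sum)
  qed
  have card_le: "card B \<le> reldim V I"
    if "mp.subspace V" "V \<subseteq> poly_ring r" "finite B" "B \<subseteq> V" "indep_mod I B" for V B
  proof (rule card_le_reldim[OF that(1) _ _ that(3-5)])
    show "finite A" by (simp add: A_def)
  qed (use tail that(2) in blast)
  have high: "(hom_part r d :: 'k mpoly set) \<subseteq> I" if "d > e" for d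
  proof
    fix p :: "'k mpoly" assume p: "p \<in> hom_part r d"
    show "p \<in> I"
    proof (rule ccontr)
      assume "p \<notin> I"
      then have "card {p} \<le> hilb r I d"
        unfolding hilb_def using p
        by (intro card_le subspace_hom_part hom_part_subset_poly_ring indep_mod_single sI) auto
      then show False using he'[OF that] by simp
    qed
  qed
  have "\<not> hom_part r e \<subseteq> I"
    using he reldim_eq_0[OF subspace_hom_part, of r e I] by (auto simp: hilb_def)
  then obtain s where s: "s \<in> hom_part r e" "s \<notin> I" by blast
  have socle_e: "hom_part r e \<subseteq> socle_pre r I"
    using high[of "Suc e"] hom_part_mult[OF Var_hom_part, of _ r _ e] hom_part_subset_poly_ring[of r e]
    by (fastforce simp: socle_pre_def)
  have unit: "q \<in> I" if "const a * q \<in> I" "a \<noteq> 0" for a q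
  proof -
    have "const (inverse a) * (const a * q) \<in> I" using mp.subspace_scale[OF sI that(1)] .
    then show ?thesis using that(2) by (simp only: mp.scale_scale) simp
  qed
  have dep: "\<exists>c. p - const c * s \<in> I" if p: "p \<in> socle_pre r I" for p
  proof (cases "p = s")
    case True
    then show ?thesis using mp.subspace_0[OF sI] by (intro exI[of _ 1]) simp
  next
    case False
    \<comment> \<open>A class independent of \<open>s\<close> would make the socle at least
      two-dimensional. The case \<open>p = s\<close> was split off because \<open>{p, s}\<close>
      then has a single element.\<close>
    have "\<not> indep_mod I {p, s}"
    proof
      assume "indep_mod I {p, s}"
      then have "card {p, s} \<le> reldim (socle_pre r I) I"
        using p s socle_e by (intro card_le subspace_socle ideal) (auto simp: socle_pre_def)
      then show False using soc1 False by simp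
    qed
    then obtain c where c: "const (c p) * p + const (c s) * s \<in> I" "c p \<noteq> 0 \<or> c s \<noteq> 0"
      using False by (auto simp: indep_mod_def)
    have "c p \<noteq> 0"
    proof
      assume "c p = 0"
      then show False using c unit[of "c s" s] s(2) by simp
    qed
    moreover have "const (c p) * (p - const (- c s / c p) * s) = const (c p) * p + const (c s) * s"
      using \<open>c p \<noteq> 0\<close> unfolding mp.scale_right_diff_distrib mp.scale_scale
      by (simp add: const_def single_uminus)
    ultimately show ?thesis using unit c(1) by metis
  qed
  have "\<exists>c. Poly_Mapping.single m 1 - const c * s \<in> I" if "m \<in> monomials r e" for m
    using dep socle_e single_hom_part[OF that] by blast
  \<comment> \<open>\<open>\<phi> m\<close> is the coordinate of the monomial \<open>m\<close> along
    \<open>s\<close>; \<open>\<Phi>\<close> extends it by zero to all other monomials.\<close>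
  then obtain \<phi> where \<phi>: "\<And>m. m \<in> monomials r e \<Longrightarrow> Poly_Mapping.single m 1 - const (\<phi> m) * s \<in> I"
    by metis
  define \<Phi> where "\<Phi> m = (if m \<in> monomials r e then \<phi> m else 0)" for m
  have \<Phi>: "\<Phi> \<in> supported (monomials r e)" by (simp add: supported_def \<Phi>_def)
  have act_s: "p - const (act p \<Phi> 0) * s \<in> I" if p: "p \<in> hom_part r e" for p
  proof -
    have "(\<Sum>m\<in>keys p. const (lookup p m) * (Poly_Mapping.single m 1 - const (\<Phi> m) * s)) \<in> I"
      using p \<phi> by (intro mp.subspace_sum mp.subspace_scale sI) (auto simp: \<Phi>_def hom_part_iff)
    also have "(\<Sum>m\<in>keys p. const (lookup p m) * (Poly_Mapping.single m 1 - const (\<Phi> m) * s))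
      = (\<Sum>m\<in>keys p. const (lookup p m) * Poly_Mapping.single m 1) - const (act p \<Phi> 0) * s"
      by (simp add: mp.scale_right_diff_distrib sum_subtractf mp.scale_sum_left act_def)
    also have "(\<Sum>m\<in>keys p. const (lookup p m) * Poly_Mapping.single m 1) = p"
      by (subst (3) mpoly_eq_sum) (simp add: const_def mult_single)
    finally show ?thesis .
  qed
  have I_e: "p \<in> I \<longleftrightarrow> act p \<Phi> 0 = 0" if p: "p \<in> hom_part r e" for p
  proof
    assume "p \<in> I"
    then have *: "const (act p \<Phi> 0) * s \<in> I" using mp.subspace_diff[OF sI _ act_s[OF p]] by fastforce
    then show "act p \<Phi> 0 = 0" using unit s(2) by blast
  qed (use act_s[OF p] in auto)
  have shift: "act (Poly_Mapping.single m 1 * p) \<Phi> 0 = act p \<Phi> m" for m p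
    by (simp add: act_mult act_single)
  have "p \<in> I \<longleftrightarrow> act p \<Phi> = 0" if p: "p \<in> hom_part r d" for d p
  proof
    assume "p \<in> I"
    show "act p \<Phi> = 0"
    proof
      fix m
      show "act p \<Phi> m = 0 m"
      proof (cases "m \<in> monomials r (mon_deg m) \<and> mon_deg m + d = e")
        case True
        then have "Poly_Mapping.single m 1 * p \<in> hom_part r e"
          using hom_part_mult[OF single_hom_part p] by metis
        moreover have "Poly_Mapping.single m 1 * p \<in> I"
          using True mult[OF \<open>p \<in> I\<close>] single_hom_part hom_part_subset_poly_ring by blast
        ultimately show ?thesis using I_e shift by simp
      next
        case False
        have "\<Phi> (a + m) = 0" if "a \<in> keys p" for a
          using False that p monomials_addD[of a m r e]
          by (auto simp: \<Phi>_def hom_part_iff monomials_def)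
        then show ?thesis by (simp add: act_def)
      qed
    qed
  next
    assume 0: "act p \<Phi> = 0"
    show "p \<in> I"
    proof (rule ccontr)
      assume "p \<notin> I"
      \<comment> \<open>Degrees of the monomials that keep \<open>p\<close> outside
        \<open>I\<close>. This set contains 0 and is bounded by artinianity; a multiple at its
        maximum is sent into \<open>I\<close> by every variable.\<close>
      define J where "J = {j. \<exists>m\<in>monomials r j. Poly_Mapping.single m 1 * p \<notin> I}"
      have "0 \<in> J" using \<open>p \<notin> I\<close> by (simp add: J_def)
      have "J \<subseteq> {..N}"
      proof
        fix j assume "j \<in> J"
        then obtain m where "m \<in> monomials r j" "Poly_Mapping.single m 1 * p \<notin> I" by (auto simp: J_def)
        then have "\<not> N \<le> j + d" using N hom_part_mult[OF single_hom_part p] by blast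
        then show "j \<in> {..N}" by simp
      qed
      then have "finite J" using finite_subset by blast
      define j where "j = Max J"
      have "j \<in> J" unfolding j_def using \<open>finite J\<close> \<open>0 \<in> J\<close> by (intro Max_in) auto
      have "Suc j \<notin> J" using Max_ge[OF \<open>finite J\<close>, of "Suc j"] by (auto simp: j_def)
      from \<open>j \<in> J\<close> obtain m where m: "m \<in> monomials r j" "Poly_Mapping.single m 1 * p \<notin> I" by (auto simp: J_def)
      let ?q = "Poly_Mapping.single m 1 * p"
      have q: "?q \<in> hom_part r (j + d)" using hom_part_mult[OF single_hom_part[OF m(1)] p] .
      have "Var l * ?q \<in> I" if "l < r" for l
      proof -
        have "X l + m \<in> monomials r (Suc j)" using monomials_add[OF X_monomials[OF that] m(1)] by simp
        then have "Poly_Mapping.single (X l + m) 1 * p \<in> I" using \<open>Suc j \<notin> J\<close> by (auto simp: J_def)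
        then show ?thesis by (simp add: mult.assoc[symmetric] Var_times_single)
      qed
      then have "?q \<in> socle_pre r I"
        using q hom_part_subset_poly_ring by (auto simp: socle_pre_def)
      then obtain c where c: "?q - const c * s \<in> I" using dep by blast
      have cs: "const c * s \<in> hom_part r e" using mp.subspace_scale[OF subspace_hom_part s(1)] .
      \<comment> \<open>Otherwise \<open>?q\<close> is the component of degree \<open>j + d\<close>
        of \<open>?q - const c * s\<close>, and homogeneity puts it into \<open>I\<close>.\<close>
      have "j + d = e"
      proof (rule ccontr)
        assume "j + d \<noteq> e"
        then have "hcomp (j + d) (?q - const c * s) = ?q"
          using hcomp_hom[OF q] hcomp_hom[OF cs] by (simp add: hcomp_diff)
        then show False using hom[OF c, of "j + d"] m(2) by simp
      qed
      then have "act ?q \<Phi> 0 \<noteq> 0" using I_e q m(2) by metis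
      then show False using shift 0 by simp
    qed
  qed
  then show thesis using that \<Phi> by blast
qed

section \<open>Lower bounds\<close>

text \<open>The space \<open>D\<^sub>k\<close> of the introduction. If \<open>\<Phi>\<close> is dual
  to \<open>I\<close>, contraction identifies it with the part of degree \<open>k\<close> of the
  quotient by \<open>I\<close>.\<close>

definition derivs :: "nat \<Rightarrow> nat \<Rightarrow> ((nat \<Rightarrow>\<^sub>0 nat) \<Rightarrow> 'k::field) \<Rightarrow> ((nat \<Rightarrow>\<^sub>0 nat) \<Rightarrow> 'k) set" where
  "derivs r k \<Phi> = (\<lambda>p. act p \<Phi>) ` hom_part r k"

lemma hom_part_span:
  "hom_part r k = mp.span ((\<lambda>m. Poly_Mapping.single m (1::'k::field)) ` monomials r k)"
  (is "_ = mp.span ?S")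
proof (rule mp.span_subspace[symmetric])
  show "hom_part r k \<subseteq> mp.span ?S"
  proof
    fix p :: "'k mpoly" assume p: "p \<in> hom_part r k"
    have "(\<Sum>m\<in>keys p. const (lookup p m) * Poly_Mapping.single m 1) \<in> mp.span ?S"
      using p by (intro mp.span_sum mp.span_scale mp.span_base) (auto simp: hom_part_iff)
    then show "p \<in> mp.span ?S"
      by (simp add: const_def mult_single flip: mpoly_eq_sum)
  qed
qed (use single_hom_part subspace_hom_part in auto)

lemma derivs_span: "derivs r k \<Phi> = fn.span ((\<lambda>m. act (Poly_Mapping.single m 1) \<Phi>) ` monomials r k)"
  unfolding derivs_def hom_part_span act.span_image[symmetric] image_image ..

lemma subspace_derivs: "fn.subspace (derivs r k \<Phi>)"
  by (simp add: derivs_span)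

lemma fin_dim_derivs: "fn.fin_dim (derivs r k \<Phi>)"
  unfolding derivs_span by (intro fn.fin_dim_span) simp

lemma hilb_eq_dim_derivs:
  assumes "\<And>p. p \<in> hom_part r d \<Longrightarrow> p \<in> I \<longleftrightarrow> act p \<Phi> = 0"
  shows "hilb r I d = fn.dim (derivs r d \<Phi>)"
  unfolding hilb_def derivs_def
  using assms fin_dim_derivs by (intro reldim_eq_dim_image linear_act subspace_hom_part) (auto simp: derivs_def)

lemma linear_act_right: "Vector_Spaces.linear fun_scale fun_scale (act p)"
  by unfold_locales (auto simp: act_def fun_scale_def fun_eq_iff sum_distrib_left sum.distrib algebra_simps)

interpretation act_right: Vector_Spaces.linear fun_scale fun_scale "act p" for p :: "'k::field mpoly"
  by (rule linear_act_right)

lemma act_commute: "act p (act q \<phi>) = act q (act p \<phi>)"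
  by (metis act_mult mult.commute)

interpretation forms: commuting_operators fun_scale "act ` (hom_part r (Suc 0) :: 'k::field mpoly set)" for r
proof unfold_locales
  fix S T :: "((nat \<Rightarrow>\<^sub>0 nat) \<Rightarrow> 'k) \<Rightarrow> (nat \<Rightarrow>\<^sub>0 nat) \<Rightarrow> 'k" and t
  assume "S \<in> act ` hom_part r (Suc 0)" "T \<in> act ` hom_part r (Suc 0)"
  then obtain p q where pq: "p \<in> hom_part r (Suc 0)" "S = act p" "q \<in> hom_part r (Suc 0)" "T = act q"
    by blast
  then show "S (T x) = T (S x)" for x by (simp add: act_commute)
  have "p + const t * q \<in> hom_part r (Suc 0)"
    using pq by (intro mp.subspace_add mp.subspace_scale subspace_hom_part)
  then show "(\<lambda>x. S x + fun_scale t (T x)) \<in> act ` hom_part r (Suc 0)"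
    unfolding pq by (intro image_eqI[of _ _ "p + const t * q"]) (simp_all add: fun_eq_iff act_add act_const_times)
qed (auto simp: act_right.add act_right.scale)

lemma act_derivs_subset:
  assumes "l \<in> hom_part r (Suc 0)"
  shows "act l ` derivs r k \<Phi> \<subseteq> derivs r (Suc k) \<Phi>"
proof
  fix \<phi> assume "\<phi> \<in> act l ` derivs r k \<Phi>"
  then obtain p where p: "p \<in> hom_part r k" "\<phi> = act (l * p) \<Phi>" by (auto simp: derivs_def act_mult)
  then show "\<phi> \<in> derivs r (Suc k) \<Phi>" using hom_part_mult[OF assms p(1)] by (simp add: derivs_def)
qed

text \<open>The rank of \<open>l\<close> on derivatives of \<open>\<Phi>\<close> becomes the
  dimension of a space of derivatives of \<open>act l \<Phi>\<close>, to which the symmetry in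
  \<open>dim_derivs_le\<close> applies.\<close>

lemma act_derivs: "act l ` derivs r k \<Phi> = derivs r k (act l \<Phi>)"
  by (simp add: derivs_def image_image act_commute[of l])

lemma act_supported:
  assumes "p \<in> hom_part r c" "\<phi> \<in> supported (monomials r (c + d))"
  shows "act p \<phi> \<in> supported (monomials r d)"
  unfolding supported_def
proof (clarify)
  fix m assume "act p \<phi> m \<noteq> 0"
  then obtain a where a: "a \<in> keys p" "\<phi> (a + m) \<noteq> 0"
    unfolding act_def by (auto elim: sum.not_neutral_contains_not_neutral)
  then have "a + m \<in> monomials r (c + d)" using assms(2) by (auto simp: supported_def)
  moreover have "mon_deg a = c" using a(1) assms(1) by (auto simp: hom_part_def)
  ultimately show "m \<in> monomials r d" using monomials_addD[of a m r "c + d"] by auto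
qed

lemma derivs_supported:
  "\<Phi> \<in> supported (monomials r (k + d)) \<Longrightarrow> derivs r k \<Phi> \<subseteq> supported (monomials r d)"
  using act_supported by (fastforce simp: derivs_def)

text \<open>A nonzero value at \<open>m = X j + m'\<close> reappears at \<open>m'\<close> after
  contraction by the variable \<open>X j\<close>, and each contraction lowers the degree by
  one.\<close>

lemma cogenerated_supported:
  "forms.cogenerated r d (supported (monomials r d) :: ((nat \<Rightarrow>\<^sub>0 nat) \<Rightarrow> 'k::field) set)"
proof (induction d)
  case (Suc d)
  have "\<phi> = 0" if \<phi>: "\<phi> \<in> supported (monomials r (Suc d))" and
    0: "\<And>p :: 'k mpoly. p \<in> hom_part r (Suc 0) \<Longrightarrow> act p \<phi> = 0" for \<phi> :: "(nat \<Rightarrow>\<^sub>0 nat) \<Rightarrow> 'k"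
  proof
    fix m
    show "\<phi> m = 0 m"
    proof (rule ccontr)
      assume nz: "\<phi> m \<noteq> 0 m"
      then have "m \<in> monomials r (Suc d)" using \<phi> by (simp add: supported_def)
      then obtain j m' where j: "j < r" "m = X j + m'" by (rule monomials_SucE)
      have "act (Poly_Mapping.single (X j) 1) \<phi> m' = \<phi> m" by (simp add: act_single j(2))
      then show False using 0[OF single_hom_part[OF X_monomials[OF j(1)]], of 1] nz by simp
    qed
  qed
  moreover have "forms.cogenerated r d (act p ` supported (monomials r (Suc d)))"
    if "p \<in> hom_part r (Suc 0)" for p :: "'k mpoly"
    by (rule forms.cogenerated_subset[OF Suc]) (use act_supported[OF that, of _ d] in auto)
  ultimately show ?case by auto
qed simp

lemma green_derivs:
  fixes \<Phi> :: "(nat \<Rightarrow>\<^sub>0 nat) \<Rightarrow> 'k::field"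
  assumes "infinite (UNIV :: 'k set)" "\<Phi> \<in> supported (monomials r (k + Suc d))"
    and "D \<subseteq> derivs r k \<Phi>" "fn.subspace D" "1 \<le> x" "forms_dim (Suc d) x \<le> fn.dim D"
  obtains l where "l \<in> hom_part r (Suc 0)" "forms_dim d x \<le> fn.dim (act l ` D)"
proof -
  have "forms.cogenerated r (Suc d) D"
    by (rule forms.cogenerated_subset[OF cogenerated_supported])
      (use assms(3) derivs_supported[OF assms(2)] in blast)
  from forms.green[OF assms(1,4) fn.fin_dim_subset[OF fin_dim_derivs assms(3)] this assms(5,6)]
  show thesis using that by blast
qed

lemma derivs_Suc_lower:
  fixes \<Phi> :: "(nat \<Rightarrow>\<^sub>0 nat) \<Rightarrow> 'k::field"
  assumes "infinite (UNIV :: 'k set)" "\<Phi> \<in> supported (monomials r (k + Suc d))"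
    and "1 \<le> x" "forms_dim (Suc d) x \<le> fn.dim (derivs r k \<Phi>)"
  shows "forms_dim d x \<le> fn.dim (derivs r (Suc k) \<Phi>)"
proof -
  obtain l where l: "l \<in> hom_part r (Suc 0)" "forms_dim d x \<le> fn.dim (act l ` derivs r k \<Phi>)"
    using green_derivs[OF assms(1,2) subset_refl subspace_derivs assms(3,4)] .
  note l(2)
  also have "real (fn.dim (act l ` derivs r k \<Phi>)) \<le> fn.dim (derivs r (Suc k) \<Phi>)"
    using fn.dim_mono_fin[OF fin_dim_derivs act_derivs_subset[OF l(1)]] by simp
  finally show ?thesis .
qed

text \<open>The same real \<open>x\<close> passes through every step; only the index of the
  polynomial drops, from \<open>e - 1\<close> in degree 1 to \<open>e - i\<close> in degree
  \<open>i\<close>.\<close>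

lemma derivs_lower:
  fixes \<Phi> :: "(nat \<Rightarrow>\<^sub>0 nat) \<Rightarrow> 'k::field"
  assumes "infinite (UNIV :: 'k set)" "\<Phi> \<in> supported (monomials r e)"
    and x: "1 \<le> x" "forms_dim (e - 1) x \<le> fn.dim (derivs r 1 \<Phi>)" and "1 \<le> i" "i \<le> e"
  shows "forms_dim (e - i) x \<le> fn.dim (derivs r i \<Phi>)"
  using \<open>1 \<le> i\<close> \<open>i \<le> e\<close>
proof (induction i rule: dec_induct)
  case (step k)
  then have "e = k + Suc (e - Suc k)" "Suc (e - Suc k) = e - k" by auto
  then show ?case using derivs_Suc_lower[of \<Phi> r k "e - Suc k" x] assms step by auto
qed (use x in auto)

text \<open>Row rank equals column rank for the matrix \<open>\<psi> (\<mu> + \<nu>)\<close>.\<close>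

lemma dim_derivs_le:
  assumes \<psi>: "\<psi> \<in> supported (monomials r (k + l))"
  shows "fn.dim (derivs r k \<psi>) \<le> fn.dim (derivs r l \<psi>)"
proof -
  obtain C where C: "finite C" "fn.span C = derivs r l \<psi>" "card C = fn.dim (derivs r l \<psi>)"
    using fn.fin_dim_basis[OF subspace_derivs fin_dim_derivs] by metis
  have "\<exists>u. act (Poly_Mapping.single \<nu> 1) \<psi> = (\<Sum>c\<in>C. fun_scale (u c) c)" if "\<nu> \<in> monomials r l" for \<nu>
  proof -
    have "act (Poly_Mapping.single \<nu> 1) \<psi> \<in> fn.span C"
      unfolding C(2) derivs_def using single_hom_part[OF that] by blast
    then show ?thesis unfolding fn.span_finite[OF C(1)] by blast
  qed
  then obtain a where a: "\<And>\<nu>. \<nu> \<in> monomials r l \<Longrightarrow>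
      act (Poly_Mapping.single \<nu> 1) \<psi> = (\<Sum>c\<in>C. fun_scale (a \<nu> c) c)" by metis
  \<comment> \<open>Now \<open>\<psi> (\<mu> + \<nu>)\<close> is the sum of
    \<open>a \<nu> c * c \<mu>\<close> over \<open>C\<close>, so every row is a combination of the
    functions \<open>A c\<close>. They vanish outside degree \<open>l\<close>, as the rows
    do.\<close>
  define A where "A c = (\<lambda>\<nu>. if \<nu> \<in> monomials r l then a \<nu> c else 0)" for c
  have "act (Poly_Mapping.single \<mu> 1) \<psi> \<in> fn.span (A ` C)" if \<mu>: "\<mu> \<in> monomials r k" for \<mu>
  proof -
    have "act (Poly_Mapping.single \<mu> 1) \<psi> = (\<Sum>c\<in>C. fun_scale (c \<mu>) (A c))"
    proof
      fix \<nu>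
      show "act (Poly_Mapping.single \<mu> 1) \<psi> \<nu> = (\<Sum>c\<in>C. fun_scale (c \<mu>) (A c)) \<nu>"
      proof (cases "\<nu> \<in> monomials r l")
        case True
        have "act (Poly_Mapping.single \<mu> 1) \<psi> \<nu> = act (Poly_Mapping.single \<nu> 1) \<psi> \<mu>"
          by (simp add: act_single add.commute)
        also have "\<dots> = (\<Sum>c\<in>C. a \<nu> c * c \<mu>)"
          by (simp add: a[OF True] sum_fun_apply fun_scale_def)
        finally show ?thesis using True by (simp add: sum_fun_apply fun_scale_def A_def mult.commute)
      next
        case False
        then have "\<psi> (\<mu> + \<nu>) = 0"
          using \<psi> \<mu> monomials_addD[of \<mu> \<nu> r "k + l"] by (auto simp: supported_def monomials_def)
        then show ?thesis using False by (simp add: act_single sum_fun_apply fun_scale_def A_def)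
      qed
    qed
    then show ?thesis by (simp add: fn.span_sum fn.span_scale fn.span_base)
  qed
  then have "derivs r k \<psi> \<subseteq> fn.span (A ` C)"
    unfolding derivs_span by (intro fn.span_minimal) auto
  then have "fn.dim (derivs r k \<psi>) \<le> card (A ` C)" using C(1) by (intro fn.dim_le_card) auto
  also have "\<dots> \<le> card C" using C(1) by (rule card_image_le)
  finally show ?thesis using C(3) by simp
qed

text \<open>If \<open>l\<close> has rank at least twice the target on \<open>?D\<close>, its image
  inside \<open>?E\<close> suffices. Otherwise its kernel on \<open>?D\<close> is large, and
  rank-nullity for \<open>l\<close> on \<open>?E\<close> adds the rank, bounded below by symmetry,
  to the kernel, bounded below by Green's theorem.\<close>

lemma derivs_middle_lower:
  fixes \<Phi> :: "(nat \<Rightarrow>\<^sub>0 nat) \<Rightarrow> 'k::field"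
  assumes inf: "infinite (UNIV :: 'k set)" and \<Phi>: "\<Phi> \<in> supported (monomials r (2 * Suc j))"
    and x: "3 \<le> x" "forms_dim (Suc (Suc j)) x \<le> fn.dim (derivs r j \<Phi>)"
  shows "2 * forms_dim (Suc j) (x - 2) \<le> fn.dim (derivs r (Suc j) \<Phi>)"
proof -
  let ?D = "derivs r j \<Phi>" and ?E = "derivs r (Suc j) \<Phi>"
  have \<Phi>': "\<Phi> \<in> supported (monomials r (j + Suc (Suc j)))" using \<Phi> by (simp add: mult_2)
  obtain l where l: "l \<in> hom_part r (Suc 0)" "forms_dim (Suc j) x \<le> fn.dim (act l ` ?D)"
    using green_derivs[OF inf \<Phi>' subset_refl subspace_derivs _ x(2)] x(1) by auto
  have sub: "act l ` ?D \<subseteq> ?E" using act_derivs_subset[OF l(1)] .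
  have mono: "forms_dim (Suc j) (x - 2) \<le> forms_dim (Suc j) x" using x by (intro forms_dim_mono) auto
  show ?thesis
  proof (cases "2 * forms_dim (Suc j) (x - 2) \<le> fn.dim (act l ` ?D)")
    case True
    then show ?thesis using fn.dim_mono_fin[OF fin_dim_derivs sub] by linarith
  next
    case False
    let ?K = "{\<phi> \<in> ?D. act l \<phi> = 0}"
    have K: "fn.subspace ?K" using fn.subspace_ker[OF linear_act_right subspace_derivs] .
    have "fn.dim ?D = fn.dim (act l ` ?D) + fn.dim ?K"
      using fn.rank_nullity[OF linear_act_right subspace_derivs fin_dim_derivs] .
    then have "forms_dim (Suc (Suc j)) x - 2 * forms_dim (Suc j) (x - 2) \<le> fn.dim ?K"
      using x(2) False by linarith
    moreover have "forms_dim (Suc j) (x - 2) \<le> forms_dim (Suc j) (x - 1)"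
      using x by (intro forms_dim_mono) auto
    \<comment> \<open>Two Pascal steps, from \<open>x\<close> to \<open>x - 1\<close> and on to
      \<open>x - 2\<close>, pay for the subtracted pair of terms. The assumption
      \<open>3 \<le> x\<close> keeps \<open>x - 2\<close> in the range of Green's theorem.\<close>
    ultimately have "forms_dim (Suc (Suc j)) (x - 2) \<le> fn.dim ?K"
      using mono forms_dim_pascal[of "Suc j" x] forms_dim_pascal[of "Suc j" "x - 1"] by simp
    then obtain l' where l': "l' \<in> hom_part r (Suc 0)" "forms_dim (Suc j) (x - 2) \<le> fn.dim (act l' ` ?K)"
      using green_derivs[OF inf \<Phi>' _ K, of "x - 2"] x(1) by auto
    have "act l' ` ?K \<subseteq> {\<phi> \<in> ?E. act l \<phi> = 0}"
      using act_derivs_subset[OF l'(1), of j \<Phi>] by (auto simp: act_commute[of l])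
    then have "fn.dim (act l' ` ?K) \<le> fn.dim {\<phi> \<in> ?E. act l \<phi> = 0}"
      by (intro fn.dim_mono_fin fn.fin_dim_subset[OF fin_dim_derivs]) auto
    \<comment> \<open>\<open>act l \<Phi>\<close> has degree \<open>j + Suc j\<close>, so its
      derivatives of orders \<open>j\<close> and \<open>Suc j\<close> are the row and column spaces
      of one matrix.\<close>
    moreover have "fn.dim (act l ` ?D) \<le> fn.dim (act l ` ?E)"
      unfolding act_derivs using \<Phi> by (intro dim_derivs_le act_supported[OF l(1)]) (simp add: mult_2)
    ultimately show ?thesis
      using l(2) l'(2) mono fn.rank_nullity[OF linear_act_right[of l] subspace_derivs[of r "Suc j" \<Phi>] fin_dim_derivs]
      by linarith
  qed
qed

text \<open>A relation among the contractions by the variables would be a linear form annihilating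
  \<open>\<Phi>\<close>.\<close>

lemma dim_derivs_1_ge:
  assumes \<Phi>: "\<And>p. p \<in> hom_part r (Suc 0) \<Longrightarrow> act p \<Phi> = 0 \<Longrightarrow> p = 0"
  shows "r \<le> fn.dim (derivs r (Suc 0) \<Phi>)"
proof -
  have ind: "a t = 0" if "(\<Sum>j<r. fun_scale (a j) (act (Var j) \<Phi>)) = 0" "t \<in> {..<r}" for a t
  proof -
    have "act (\<Sum>j<r. const (a j) * Var j) \<Phi> = 0" using that(1) by (simp add: act.sum act.scale)
    moreover have "(\<Sum>j<r. const (a j) * Var j) \<in> hom_part r (Suc 0)"
      by (intro mp.subspace_sum mp.subspace_scale subspace_hom_part) (simp add: Var_hom_part)
    ultimately have "(\<Sum>j<r. const (a j) * Var j) = 0" by (rule \<Phi>[rotated])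
    then have "lookup (\<Sum>j<r. const (a j) * Var j) (X t) = 0" by (simp only: lookup_zero)
    moreover have "X j = X t \<longleftrightarrow> j = t" for j :: nat
      by (metis lookup_single_eq lookup_single_not_eq zero_neq_one)
    ultimately show ?thesis using that(2)
      by (simp add: lookup_sum Var_def lookup_single when_def if_distrib cong: if_cong)
  qed
  let ?u = "\<lambda>j. act (Var j) \<Phi>"
  have "inj_on ?u {..<r}" by (rule fn.independent_familyI(1)) (simp, rule ind)
  moreover have "fn.independent (?u ` {..<r})" by (rule fn.independent_familyI(2)) (simp, rule ind)
  moreover have "?u ` {..<r} \<subseteq> derivs r (Suc 0) \<Phi>" by (auto simp: derivs_def Var_hom_part)
  ultimately show ?thesis
    using fn.independent_card_le_dim[OF fin_dim_derivs, of "?u ` {..<r}" r "Suc 0" \<Phi>] by (simp add: card_image)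
qed

lemma AG_hilb_lower:
  fixes I :: "'k::field mpoly set"
  assumes "infinite (UNIV :: 'k set)" "AG_algebra r e I" "1 \<le> x" "forms_dim (e - 1) x \<le> r" "1 \<le> i" "i \<le> e"
  shows "forms_dim (e - i) x \<le> hilb r I i"
    and "e = 2 * i \<Longrightarrow> 2 \<le> i \<Longrightarrow> 3 \<le> x \<Longrightarrow> 2 * forms_dim i (x - 2) \<le> hilb r I i"
proof -
  obtain \<Phi> where \<Phi>: "\<Phi> \<in> supported (monomials r e)"
    and I: "\<And>d p. p \<in> hom_part r d \<Longrightarrow> p \<in> I \<longleftrightarrow> act p \<Phi> = 0"
    by (rule AG_dual_generator[OF assms(2)]) blast
  have "r \<le> fn.dim (derivs r (Suc 0) \<Phi>)"
    using assms(2) I[of _ "Suc 0"] by (intro dim_derivs_1_ge) (auto simp: AG_algebra_def)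
  then have 1: "forms_dim (e - 1) x \<le> fn.dim (derivs r 1 \<Phi>)" using assms(4) by simp
  have hilb: "hilb r I i = fn.dim (derivs r i \<Phi>)" using I by (rule hilb_eq_dim_derivs)
  show "forms_dim (e - i) x \<le> hilb r I i"
    unfolding hilb by (rule derivs_lower[OF assms(1) \<Phi> assms(3) 1 assms(5,6)])
  show "2 * forms_dim i (x - 2) \<le> hilb r I i" if "e = 2 * i" "2 \<le> i" "3 \<le> x"
  proof -
    obtain j where j: "i = Suc j" using \<open>2 \<le> i\<close> by (cases i) auto
    \<comment> \<open>The middle bound starts from degree \<open>j = i - 1\<close>, which is
      positive because \<open>2 \<le> i\<close>; there \<open>e - j\<close> equals
      \<open>Suc (Suc j)\<close>.\<close>
    then have "forms_dim (Suc (Suc j)) x \<le> fn.dim (derivs r j \<Phi>)"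
      using derivs_lower[OF assms(1) \<Phi> assms(3) 1, of j] that by simp
    then show ?thesis
      unfolding hilb using derivs_middle_lower[OF assms(1) _ \<open>3 \<le> x\<close>, of \<Phi> r j] \<Phi> that j by simp
  qed
qed

section \<open>Construction of Gorenstein algebras with small Hilbert function\<close>

text \<open>The variables of index at least \<open>m\<close> are the \<open>y\<^sub>j\<close>, and
  \<open>g j\<close> is the monomial \<open>M\<^sub>j\<close>. The pure powers of the first
  \<open>m\<close> variables are put among the \<open>g j\<close> so that these variables too act
  independently on \<open>\<Phi>\<close>; \<open>2 * m \<le> r\<close> makes room for them.\<close>

locale monomial_pairing =
  fixes m r e :: nat and g :: "nat \<Rightarrow> nat \<Rightarrow>\<^sub>0 nat" and \<Phi> :: "(nat \<Rightarrow>\<^sub>0 nat) \<Rightarrow> 'k::field"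
  assumes m: "1 \<le> m" "2 * m \<le> r" and e: "2 \<le> e"
    and g: "\<And>j. m \<le> j \<Longrightarrow> j < r \<Longrightarrow> g j \<in> monomials m (e - 1)" "inj_on g {m..<r}"
      "\<And>a. a < m \<Longrightarrow> g (m + a) = Poly_Mapping.single a (e - 1)"
    and \<Phi>_eq: "\<Phi> = (\<lambda>\<mu>. if \<exists>j\<in>{m..<r}. \<mu> = X j + g j then 1 else 0)"
begin

lemma \<Phi>_y:
  assumes "m \<le> j" "j < r"
  shows "\<Phi> (X j + \<nu>) = (if \<nu> = g j then 1 else 0)"
proof -
  have unique: "\<nu> = g j" if j': "m \<le> j'" "j' < r" "X j + \<nu> = X j' + g j'" for j'
  proof -
    \<comment> \<open>\<open>g j'\<close> involves only variables of index below \<open>m\<close>,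
      so the single variable of higher index in a term of \<open>\<Phi>\<close> identifies the
      term.\<close>
    have "lookup (g j') j = 0"
      using g(1)[OF j'(1,2)] assms(1) by (force simp: monomials_def in_keys_iff)
    moreover have "lookup (X j' + g j') j \<noteq> 0" unfolding j'(3)[symmetric] by (simp add: lookup_add)
    ultimately have "lookup (X j') j \<noteq> 0" by (simp add: lookup_add)
    then have "j' = j" by (simp add: lookup_single when_def split: if_splits)
    then show ?thesis using j'(3) by simp
  qed
  show ?thesis
  proof (cases "\<nu> = g j")
    case True
    then have "\<exists>j'\<in>{m..<r}. X j + \<nu> = X j' + g j'" using assms by (intro bexI[of _ j]) auto
    then show ?thesis using True by (simp only: \<Phi>_eq if_True refl)
  next
    case False
    then have "\<not> (\<exists>j'\<in>{m..<r}. X j + \<nu> = X j' + g j')" using unique by (metis atLeastLessThan_iff)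
    then show ?thesis using False by (simp only: \<Phi>_eq if_False)
  qed
qed

lemma \<Phi>_x:
  assumes "keys \<mu> \<subseteq> {..<m}"
  shows "\<Phi> \<mu> = 0"
  using assms by (auto simp: \<Phi>_eq keys_add_nat)

lemma \<Phi>_supported: "\<Phi> \<in> supported (monomials r e)"
proof -
  have "X j + g j \<in> monomials r e" if "m \<le> j" "j < r" for j
  proof -
    have "g j \<in> monomials r (e - 1)" using g(1)[OF that] m by (auto simp: monomials_def)
    then have "X j + g j \<in> monomials r (Suc 0 + (e - 1))" by (intro monomials_add X_monomials that)
    then show ?thesis using e by simp
  qed
  then show ?thesis by (auto simp: supported_def \<Phi>_eq split: if_splits)
qed

definition I :: "'k mpoly set" where
  "I = {p \<in> poly_ring r. act p \<Phi> = 0}"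

lemma I_hom_part: "p \<in> hom_part r d \<Longrightarrow> p \<in> I \<longleftrightarrow> act p \<Phi> = 0"
  using hom_part_subset_poly_ring by (auto simp: I_def)

lemma hilb_I: "hilb r I d = fn.dim (derivs r d \<Phi>)"
  by (rule hilb_eq_dim_derivs) (rule I_hom_part)

lemma poly_ring_mult: "p \<in> poly_ring r \<Longrightarrow> q \<in> poly_ring r \<Longrightarrow> p * q \<in> poly_ring r"
  using keys_mult[of p q] by (fastforce simp: poly_ring_def keys_add_nat)

lemma is_ideal_I: "is_ideal r I"
  unfolding is_ideal_def
proof (intro conjI ballI)
  fix p q assume p: "p \<in> I"
  show "q * p \<in> I" if "q \<in> poly_ring r"
    using p that by (auto simp: I_def act_mult poly_ring_mult)
  assume "q \<in> I"
  then show "p + q \<in> I"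
    using p keys_add[of p q] by (simp add: I_def act_add poly_ring_def) blast
qed (auto simp: I_def poly_ring_def)

text \<open>\<open>\<Phi>\<close> lives in degree \<open>e\<close>, so the value of
  \<open>act p \<Phi>\<close> at \<open>n\<close> sees only the component of \<open>p\<close> of
  degree \<open>e - mon_deg n\<close>.\<close>

lemma homogeneous_I: "homogeneous_ideal r I"
  unfolding homogeneous_ideal_def
proof (intro conjI is_ideal_I ballI allI)
  fix p d assume p: "p \<in> I"
  have sub: "keys (hcomp d p) \<subseteq> keys p" by (simp add: hcomp_def keys_mapp_subset)
  have deg: "mon_deg a + mon_deg n \<noteq> e \<Longrightarrow> \<Phi> (a + n) = 0" for a n
    using \<Phi>_supported monomials_addD[of a n r e] by (auto simp: supported_def)
  have "act (hcomp d p) \<Phi> n = 0" for n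
  proof (cases "d + mon_deg n = e")
    case True
    have "act (hcomp d p) \<Phi> n = act p \<Phi> n"
      unfolding act_superset[OF finite_keys sub] unfolding act_def
      using True deg[of _ n] by (intro sum.cong) (auto simp: hcomp_def lookup_mapp when_def in_keys_iff)
    then show ?thesis using p by (simp add: I_def)
  next
    case False
    then show ?thesis
      unfolding act_superset[OF finite_keys sub]
      using deg[of _ n] by (intro sum.neutral) (auto simp: hcomp_def lookup_mapp when_def in_keys_iff)
  qed
  then show "hcomp d p \<in> I" using p sub by (auto simp: I_def poly_ring_def fun_eq_iff)
qed

lemma act_linear:
  assumes "p \<in> hom_part r 1"
  shows "act p \<Phi> n = (\<Sum>l<r. lookup p (X l) * \<Phi> (X l + n))"
proof -
  have "keys p \<subseteq> X ` {..<r}"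
  proof
    fix a assume "a \<in> keys p"
    then have "a \<in> monomials r (Suc 0)" using assms by (auto simp: hom_part_iff)
    then obtain j a' where "j < r" "a' \<in> monomials r 0" "a = X j + a'" by (rule monomials_SucE)
    then show "a \<in> X ` {..<r}" by simp
  qed
  moreover have "inj_on X {..<r}"
    by (rule inj_onI) (metis lookup_single_eq lookup_single_not_eq zero_neq_one)
  ultimately show ?thesis by (subst act_superset[of "X ` {..<r}"]) (simp_all add: sum.reindex)
qed

lemma act_linear_eq_coeff:
  assumes "p \<in> hom_part r 1" "j < r" "\<And>l. l < r \<Longrightarrow> \<Phi> (X l + n) = (if l = j then 1 else 0)"
  shows "act p \<Phi> n = lookup p (X j)"
proof -
  have "act p \<Phi> n = (\<Sum>l<r. lookup p (X l) * (if l = j then 1 else 0))"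
    unfolding act_linear[OF assms(1)] by (intro sum.cong refl) (simp only: assms(3) lessThan_iff)
  also have "\<dots> = (\<Sum>l<r. if l = j then lookup p (X j) else 0)" by (intro sum.cong) auto
  finally show ?thesis using assms(2) by simp
qed

text \<open>Each coefficient is read off at a test monomial: at \<open>g j\<close> for
  \<open>j \<ge> m\<close>, where injectivity of \<open>g\<close> isolates it, and at
  \<open>X (m + j)\<close> times the power \<open>e - 2\<close> of the variable \<open>j\<close> for
  \<open>j < m\<close>.\<close>

lemma no_linear_forms:
  assumes p: "p \<in> hom_part r 1" and 0: "act p \<Phi> = 0"
  shows "p = 0"
proof -
  have coeff: "lookup p (X j) = 0" if "j < r" for j
  proof (cases "j < m")
    case True
    let ?n = "X (m + j) + Poly_Mapping.single j (e - 2)"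
    have "\<Phi> (X l + ?n) = (if l = j then 1 else 0)" for l
    proof -
      have "X l + ?n = X (m + j) + (X l + Poly_Mapping.single j (e - 2))" by (simp add: ac_simps)
      moreover have "X l + Poly_Mapping.single j (e - 2) = g (m + j) \<longleftrightarrow> l = j"
      proof
        assume "X l + Poly_Mapping.single j (e - 2) = g (m + j)"
        then have "lookup (X l + Poly_Mapping.single j (e - 2)) l = lookup (Poly_Mapping.single j (e - 1)) l"
          using g(3)[OF True] by simp
        then show "l = j" by (simp add: lookup_add lookup_single when_def split: if_splits)
      next
        assume "l = j"
        then have "X l + Poly_Mapping.single j (e - 2) = Poly_Mapping.single j (1 + (e - 2))"
          by (simp only: single_add)
        also have "1 + (e - 2) = e - 1" using e by simp
        finally show "X l + Poly_Mapping.single j (e - 2) = g (m + j)" using g(3)[OF True] by simp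
      qed
      ultimately show ?thesis using \<Phi>_y[of "m + j" "X l + Poly_Mapping.single j (e - 2)"] True m by simp
    qed
    then have "act p \<Phi> ?n = lookup p (X j)" by (rule act_linear_eq_coeff[OF p that])
    then show ?thesis using 0 by simp
  next
    case False
    have gj: "keys (g j) \<subseteq> {..<m}" using g(1)[of j] False that by (auto simp: monomials_def)
    have "\<Phi> (X l + g j) = (if l = j then 1 else 0)" if "l < r" for l
    proof (cases "l < m")
      case True
      then show ?thesis using gj False by (subst \<Phi>_x) (auto simp: keys_add_nat)
    next
      case l: False
      then show ?thesis
        using \<Phi>_y[of l "g j"] inj_onD[OF g(2), of j l] False that \<open>j < r\<close> by auto
    qed
    then have "act p \<Phi> (g j) = lookup p (X j)" by (rule act_linear_eq_coeff[OF p that])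
    then show ?thesis using 0 by simp
  qed
  show ?thesis
  proof (rule poly_mapping_eqI)
    fix a
    show "lookup p a = lookup 0 a"
    proof (cases "a \<in> keys p")
      case True
      then have "a \<in> monomials r (Suc 0)" using p by (auto simp: hom_part_iff)
      then obtain j a' where "j < r" "a' \<in> monomials r 0" "a = X j + a'" by (rule monomials_SucE)
      then show ?thesis using coeff by simp
    qed (simp add: in_keys_iff)
  qed
qed

lemma high_degree: "e < d \<Longrightarrow> hom_part r d \<subseteq> I"
proof
  fix p :: "'k mpoly" assume d: "e < d" and p: "p \<in> hom_part r d"
  have "\<Phi> (a + n) = 0" if "a \<in> keys p" for a n
  proof (rule ccontr)
    assume "\<Phi> (a + n) \<noteq> 0"
    then have "mon_deg a + mon_deg n = e"
      using \<Phi>_supported monomials_addD[of a n r e] by (auto simp: supported_def)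
    moreover have "mon_deg a = d" using that p by (auto simp: hom_part_def)
    ultimately show False using d by simp
  qed
  then have "act p \<Phi> = 0" by (auto simp: act_def)
  then show "p \<in> I" using I_hom_part[OF p] by simp
qed

text \<open>The term \<open>X m + g m\<close> of \<open>\<Phi>\<close> contracts it to the
  functional that is 1 at the trivial monomial and 0 elsewhere, which spans the image of the
  socle.\<close>

lemma delta_0_derivs:
  obtains p where "p \<in> hom_part r e" "act p \<Phi> = delta 0"
proof
  have mr: "m < r" using m by simp
  have "g m \<in> monomials r (e - 1)" using g(1)[of m] mr by (auto simp: monomials_def)
  then have "X m + g m \<in> monomials r (Suc 0 + (e - 1))" by (intro monomials_add X_monomials mr)
  then show "Poly_Mapping.single (X m + g m) 1 \<in> hom_part r e"
    using e by (intro single_hom_part) simp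
  have "\<Phi> (X m + g m + n) = delta 0 n" for n
    using \<Phi>_y[of m "g m + n"] mr by (simp add: delta_def add.assoc)
  then show "act (Poly_Mapping.single (X m + g m) 1) \<Phi> = delta 0"
    by (simp add: act_single fun_eq_iff)
qed

text \<open>Every variable annihilates the contraction by a socle element, so that contraction
  vanishes at each nontrivial monomial and is a multiple of \<open>delta 0\<close>.\<close>

lemma socle_image: "fn.dim ((\<lambda>p. act p \<Phi>) ` socle_pre r I) = 1"
  and fin_dim_socle_image: "fn.fin_dim ((\<lambda>p. act p \<Phi>) ` socle_pre r I)"
proof -
  let ?S = "(\<lambda>p. act p \<Phi>) ` socle_pre r I"
  obtain p0 where p0: "p0 \<in> hom_part r e" "act p0 \<Phi> = delta 0" by (rule delta_0_derivs)
  have "Var j * p0 \<in> I" if "j < r" for j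
    using hom_part_mult[OF Var_hom_part[OF that] p0(1)] high_degree[of "Suc 0 + e"] by auto
  then have p0_soc: "p0 \<in> socle_pre r I"
    using p0(1) hom_part_subset_poly_ring by (auto simp: socle_pre_def)
  have sub: "?S \<subseteq> fn.span {delta 0}"
  proof
    fix \<phi> assume "\<phi> \<in> ?S"
    then obtain p where p: "p \<in> socle_pre r I" "\<phi> = act p \<Phi>" by blast
    have "\<phi> n = fun_scale (\<phi> 0) (delta 0) n" for n
    proof (cases "n = 0 \<or> \<phi> n = 0")
      case False
      then obtain j where j: "j \<in> keys n" by (metis all_not_in_conv keys_eq_empty)
      have nz: "(\<Sum>a\<in>keys p. lookup p a * \<Phi> (a + n)) \<noteq> 0"
        using False by (simp add: p(2) act_def)
      obtain a where "lookup p a * \<Phi> (a + n) \<noteq> 0"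
        by (rule sum.not_neutral_contains_not_neutral[OF nz])
      then have "\<Phi> (a + n) \<noteq> 0" by auto
      then have "j < r" using \<Phi>_supported j by (force simp: supported_def monomials_def keys_add_nat)
      from j obtain n' where n': "n = X j + n'" by (rule split_variable)
      have "act (Var j * p) \<Phi> = 0" using p(1) \<open>j < r\<close> by (auto simp: socle_pre_def I_def)
      then have "act (Var j) \<phi> n' = 0" by (simp add: act_mult p(2))
      then have "\<phi> n = 0" by (simp add: Var_def act_single n')
      then show ?thesis using False by simp
    qed (auto simp: fun_scale_def delta_def)
    then have "\<phi> = fun_scale (\<phi> 0) (delta 0)" by blast
    then show "\<phi> \<in> fn.span {delta 0}" using fn.span_scale[OF fn.span_base] by (metis singletonI)
  qed
  then show fd: "fn.fin_dim ?S" unfolding fn.fin_dim_def by blast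
  have "delta 0 \<in> ?S" using p0_soc p0(2) by (metis imageI)
  moreover have "delta 0 \<noteq> (0 :: (nat \<Rightarrow>\<^sub>0 nat) \<Rightarrow> 'k)" by (auto simp: delta_def fun_eq_iff)
  ultimately have "0 < fn.dim ?S" by (rule fn.dim_pos[OF fd])
  moreover have "fn.dim ?S \<le> 1" using fn.dim_le_card[OF sub] by simp
  ultimately show "fn.dim ?S = 1" by simp
qed

lemma AG_algebra_I: "AG_algebra r e I"
  unfolding AG_algebra_def
proof (intro conjI homogeneous_I allI impI)
  show "I \<inter> hom_part r 1 = {0}"
    using no_linear_forms by (auto simp: I_def poly_ring_def hom_part_def)
  show "is_artinian r I"
    unfolding is_artinian_def using high_degree by (intro exI[of _ "Suc e"]) auto
  show "reldim (socle_pre r I) I = 1"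
  proof (subst reldim_eq_dim_image[OF linear_act subspace_socle[OF is_ideal_I] _ fin_dim_socle_image])
    show "act p \<Phi> = 0 \<longleftrightarrow> p \<in> I" if "p \<in> socle_pre r I" for p
      using that by (auto simp: I_def socle_pre_def)
  qed (rule socle_image)
  obtain p where "p \<in> hom_part r e" "act p \<Phi> = delta 0" by (rule delta_0_derivs)
  then have "delta 0 \<in> derivs r e \<Phi>" by (force simp: derivs_def)
  moreover have "delta 0 \<noteq> (0 :: (nat \<Rightarrow>\<^sub>0 nat) \<Rightarrow> 'k)" by (auto simp: delta_def fun_eq_iff)
  ultimately have "0 < fn.dim (derivs r e \<Phi>)" using fn.dim_pos[OF fin_dim_derivs] by blast
  then show "hilb r I e \<noteq> 0" by (simp add: hilb_I)
  show "hilb r I d = 0" if "e < d" for d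
    unfolding hilb_def by (rule reldim_eq_0[OF subspace_hom_part high_degree[OF that]])
qed

text \<open>Monomials in the first \<open>m\<close> variables give at most
  \<open>forms_dim i m\<close> contractions. Any other monomial of degree \<open>i\<close> contains
  some variable \<open>j \<ge> m\<close>, and its contraction is supported on divisors of
  \<open>g j\<close> of degree \<open>e - i\<close>, all in the first \<open>m\<close>
  variables.\<close>

lemma hilb_I_le:
  assumes "1 \<le> i" "i \<le> e"
  shows "hilb r I i \<le> forms_dim i m + forms_dim (e - i) m"
proof -
  let ?A = "(\<lambda>\<mu>. act (Poly_Mapping.single \<mu> 1) \<Phi>) ` monomials m i"
  let ?B = "(delta :: _ \<Rightarrow> _ \<Rightarrow> 'k) ` monomials m (e - i)"
  have "act (Poly_Mapping.single \<mu> 1) \<Phi> \<in> fn.span (?A \<union> ?B)" if \<mu>: "\<mu> \<in> monomials r i" for \<mu>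
  proof (cases "keys \<mu> \<subseteq> {..<m}")
    case True
    then show ?thesis using \<mu> by (intro fn.span_base) (auto simp: monomials_def)
  next
    case False
    then obtain j where j: "j \<in> keys \<mu>" "m \<le> j" by (meson lessThan_iff not_less subsetI)
    then have "j < r" using \<mu> by (auto simp: monomials_def)
    from j(1) obtain \<mu>' where \<mu>': "\<mu> = X j + \<mu>'" by (rule split_variable)
    have "n \<in> monomials m (e - i)" if "act (Poly_Mapping.single \<mu> 1) \<Phi> n \<noteq> 0" for n
    proof -
      have "\<mu>' + n = g j"
        using that \<Phi>_y[OF j(2) \<open>j < r\<close>, of "\<mu>' + n"]
        by (simp add: act_single \<mu>' add.assoc split: if_splits)
      then have "\<mu>' + n \<in> monomials m (e - 1)" using g(1)[OF j(2) \<open>j < r\<close>] by simp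
      moreover have "Suc (mon_deg \<mu>') = i" using \<mu> by (simp add: monomials_def \<mu>' mon_deg_add)
      ultimately show ?thesis using monomials_addD[of \<mu>' n m "e - 1"] by (auto simp: monomials_def)
    qed
    then have "act (Poly_Mapping.single \<mu> 1) \<Phi> \<in> supported (monomials m (e - i))"
      by (auto simp: supported_def)
    then have "act (Poly_Mapping.single \<mu> 1) \<Phi> \<in> fn.span ?B"
      using supported_subset_span[OF finite_monomials] by blast
    then show ?thesis using fn.span_mono[of ?B "?A \<union> ?B"] by blast
  qed
  then have "derivs r i \<Phi> \<subseteq> fn.span (?A \<union> ?B)"
    unfolding derivs_span by (intro fn.span_minimal) auto
  then have "fn.dim (derivs r i \<Phi>) \<le> card (?A \<union> ?B)" by (intro fn.dim_le_card) auto
  also have "\<dots> \<le> card ?A + card ?B" using card_Un_le by blast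
  also have "\<dots> \<le> card (monomials m i) + card (monomials m (e - i))"
    by (intro add_mono card_image_le) auto
  finally have "real (hilb r I i) \<le> real (card (monomials m i) + card (monomials m (e - i)))"
    by (simp add: hilb_I)
  then show ?thesis by (simp add: card_monomials)
qed

end

lemma exists_AG_algebra:
  assumes m: "1 \<le> m" "2 * m \<le> r" "real (r - m) \<le> forms_dim (e - 1) m" and e: "2 \<le> e" "1 \<le> i" "i \<le> e"
  shows "\<exists>I :: 'k::field mpoly set. AG_algebra r e I \<and> hilb r I i \<le> forms_dim i m + forms_dim (e - i) m"
proof -
  define P where "P = (\<lambda>a. Poly_Mapping.single a (e - 1)) ` {..<m}"
  have inj: "inj_on (\<lambda>a. Poly_Mapping.single a (e - 1)) {..<m}"
  proof (rule inj_onI)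
    fix a b assume "Poly_Mapping.single a (e - 1) = Poly_Mapping.single b (e - 1)"
    then have "lookup (Poly_Mapping.single a (e - 1)) a = lookup (Poly_Mapping.single b (e - 1)) a" by simp
    then show "a = b" using e(1) by (simp add: lookup_single when_def split: if_splits)
  qed
  have P: "P \<subseteq> monomials m (e - 1)" "card P = m"
    using inj by (auto simp: P_def monomials_def card_image split: if_splits)
  \<comment> \<open>Besides the \<open>m\<close> pure powers, \<open>r - 2 * m\<close> further
    monomials are needed; the hypothesis on \<open>r - m\<close> is exactly this count.\<close>
  have "card {2 * m..<r} \<le> card (monomials m (e - 1) - P)"
    using P m card_monomials[of m "e - 1"] by (subst card_Diff_subset) (auto simp: P_def)
  then obtain h where h: "h ` {2 * m..<r} \<subseteq> monomials m (e - 1) - P" "inj_on h {2 * m..<r}"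
    using card_le_inj[of "{2 * m..<r}" "monomials m (e - 1) - P"] by auto
  define g where "g j = (if j < 2 * m then Poly_Mapping.single (j - m) (e - 1) else h j)" for j
  have "{m..<r} = {m..<2 * m} \<union> {2 * m..<r}" using m by auto
  moreover have "inj_on g {m..<2 * m}"
  proof (rule inj_onI)
    fix x y assume xy: "x \<in> {m..<2 * m}" "y \<in> {m..<2 * m}" "g x = g y"
    then have "x - m = y - m" by (intro inj_onD[OF inj]) (auto simp: g_def)
    then show "x = y" using xy by auto
  qed
  moreover have "inj_on g {2 * m..<r}" using h(2) by (auto simp: g_def inj_on_def)
  moreover have "g ` {m..<2 * m} \<subseteq> P" by (auto simp: g_def P_def)
  moreover have "g ` {2 * m..<r} \<inter> P = {}" using h(1) by (auto simp: g_def)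
  ultimately have "inj_on g {m..<r}" by (auto simp: inj_on_Un)
  moreover have "g j \<in> monomials m (e - 1)" if "m \<le> j" "j < r" for j
  proof (cases "j < 2 * m")
    case True
    then show ?thesis using that by (auto simp: g_def monomials_def split: if_splits)
  next
    case False
    then have "h j \<in> monomials m (e - 1)" using that h(1) by (auto simp: image_subset_iff)
    then show ?thesis using False by (simp add: g_def)
  qed
  moreover have "g (m + a) = Poly_Mapping.single a (e - 1)" if "a < m" for a
    using that by (simp add: g_def)
  ultimately interpret monomial_pairing m r e g
    "(\<lambda>\<mu>. if \<exists>j\<in>{m..<r}. \<mu> = X j + g j then 1 else 0) :: (nat \<Rightarrow>\<^sub>0 nat) \<Rightarrow> 'k"
    using m e by unfold_locales auto
  show ?thesis using AG_algebra_I hilb_I_le[OF assms(5,6)] by blast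
qed

section \<open>Asymptotics\<close>

lemma forms_dim_ge_power:
  assumes "0 \<le> x"
  shows "x ^ d / fact d \<le> forms_dim d x"
proof -
  have "(\<Prod>j<d. x) \<le> (\<Prod>j<d. x + real j)" using assms by (intro prod_mono) auto
  then show ?thesis
    by (simp add: forms_dim_def pochhammer_prod divide_right_mono lessThan_atLeast0)
qed

lemma forms_dim_le_power:
  assumes "0 \<le> x" "real d \<le> c"
  shows "forms_dim d x \<le> (x + c) ^ d / fact d"
proof -
  have "(\<Prod>j<d. x + real j) \<le> (\<Prod>j<d. x + c)" using assms by (intro prod_mono) auto
  then show ?thesis
    by (simp add: forms_dim_def pochhammer_prod divide_right_mono lessThan_atLeast0)
qed

text \<open>\<open>t\<close> solves the leading-order equation for
  \<open>forms_dim (e - 1) t = r\<close>. Shifting \<open>t\<close> by amounts depending only on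
  \<open>e\<close> gives an argument admissible for the lower bound and a number of variables
  admissible for the construction.\<close>

lemma f_min_bounds:
  fixes t :: real
  assumes inf: "infinite (UNIV :: 'k::field set)" and e: "3 \<le> e" and i: "1 \<le> i" "2 * i \<le> e"
    and t: "t ^ (e - 1) = fact (e - 1) * real r" "4 * fact (e - 1) \<le> t" "real e + 5 \<le> t"
  shows "(if 2 * i < e then 1 else 2) * ((t - (real e + 2)) ^ (e - i) / fact (e - i)) \<le> f_min TYPE('k) e i r"
    and "f_min TYPE('k) e i r \<le> (t + (real e + 1)) ^ i / fact i + (t + (real e + 1)) ^ (e - i) / fact (e - i)"
proof -
  define S where "S = {hilb r I i | I :: 'k mpoly set. AG_algebra r e I}"
  have f_min: "f_min TYPE('k) e i r = Inf S" by (simp add: f_min_def S_def)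
  define m where "m = nat \<lceil>t\<rceil>"
  have m: "t \<le> m" "m \<le> t + 1" using t(3) by (auto simp: m_def intro: less_imp_le)
  have r: "real r = t ^ (e - 1) / fact (e - 1)" using t(1) by (simp add: field_simps)
  \<comment> \<open>Since \<open>e \<ge> 3\<close>, \<open>r\<close> grows at least quadratically in
    \<open>t\<close>, which leaves room for \<open>2 * m \<le> r\<close>.\<close>
  have "4 * t * fact (e - 1) \<le> t ^ 2"
    using mult_left_mono[OF t(2), of t] t(3) by (simp add: power2_eq_square ac_simps)
  also have "\<dots> \<le> t ^ (e - 1)" using e t(3) by (intro power_increasing) auto
  finally have "4 * t \<le> r" by (simp add: r field_simps)
  then have m2: "2 * m \<le> r" using m t(3) by linarith
  have "real (r - m) \<le> t ^ (e - 1) / fact (e - 1)" unfolding r[symmetric] by simp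
  also have "\<dots> \<le> real m ^ (e - 1) / fact (e - 1)"
    using m(1) t(3) by (intro divide_right_mono power_mono) auto
  also have "\<dots> \<le> forms_dim (e - 1) m" by (rule forms_dim_ge_power) simp
  finally have "real (r - m) \<le> forms_dim (e - 1) m" .
  moreover have "1 \<le> m" using m t(3) by linarith
  ultimately obtain I :: "'k mpoly set" where I: "AG_algebra r e I"
      "hilb r I i \<le> forms_dim i m + forms_dim (e - i) m"
    using exists_AG_algebra[of m r e i] m2 e i by auto
  then have IS: "hilb r I i \<in> S" by (auto simp: S_def)
  have le: "forms_dim d m \<le> (t + (real e + 1)) ^ d / fact d" if "d \<le> e" for d
  proof -
    have "forms_dim d m \<le> (real m + real e) ^ d / fact d" using that by (intro forms_dim_le_power) auto
    also have "\<dots> \<le> (t + (real e + 1)) ^ d / fact d"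
      using m by (intro divide_right_mono power_mono) auto
    finally show ?thesis .
  qed
  have "f_min TYPE('k) e i r \<le> hilb r I i" unfolding f_min by (rule cInf_lower[OF IS]) simp
  then show "f_min TYPE('k) e i r \<le> (t + (real e + 1)) ^ i / fact i + (t + (real e + 1)) ^ (e - i) / fact (e - i)"
    using I(2) le[of i] le[of "e - i"] i by simp
  \<comment> \<open>The infimum of a nonempty set of naturals is attained, so the lower bound can be
    applied to an actual algebra.\<close>
  have "Inf S \<in> S" using IS by (intro Inf_nat_def1) auto
  then obtain J :: "'k mpoly set" where J: "AG_algebra r e J" "f_min TYPE('k) e i r = hilb r J i"
    unfolding f_min by (auto simp: S_def)
  \<comment> \<open>The upper estimate for \<open>forms_dim (e - 1) x\<close> costs a shift by
    \<open>e\<close>, which this choice absorbs, making the estimate equal to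
    \<open>r\<close>.\<close>
  define x where "x = t - real e"
  have "forms_dim (e - 1) x \<le> (x + real e) ^ (e - 1) / fact (e - 1)"
    using t(3) by (intro forms_dim_le_power) (auto simp: x_def)
  also have "\<dots> = r" by (simp add: x_def r)
  finally have x: "forms_dim (e - 1) x \<le> r" "3 \<le> x" using t(3) by (auto simp: x_def)
  have i': "1 \<le> i" "i \<le> e" using i by auto
  show "(if 2 * i < e then 1 else 2) * ((t - (real e + 2)) ^ (e - i) / fact (e - i)) \<le> f_min TYPE('k) e i r"
  proof (cases "2 * i < e")
    case True
    have "(t - (real e + 2)) ^ (e - i) / fact (e - i) \<le> x ^ (e - i) / fact (e - i)"
      using t(3) by (intro divide_right_mono power_mono) (auto simp: x_def)
    also have "\<dots> \<le> forms_dim (e - i) x" using x by (intro forms_dim_ge_power) simp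
    also have "\<dots> \<le> hilb r J i" using AG_hilb_lower(1)[OF inf J(1) _ x(1) i'] x(2) by simp
    finally show ?thesis using J(2) True by simp
  next
    case False
    then have ei: "e = 2 * i" "e - i = i" "2 \<le> i" using i e by auto
    have "(t - (real e + 2)) ^ i / fact i \<le> forms_dim i (x - 2)"
      using forms_dim_ge_power[of "x - 2" i] x(2) by (simp add: x_def algebra_simps)
    moreover have "2 * forms_dim i (x - 2) \<le> hilb r J i"
      using AG_hilb_lower(2)[OF inf J(1) _ x(1) i' ei(1,3) x(2)] x(2) by simp
    ultimately show ?thesis using J(2) False unfolding ei(2) by simp
  qed
qed

section \<open>Limits of shifted powers and real exponents\<close>

lemma shifted_ratio_tendsto_1: "((\<lambda>t::real. (t + a) / t) \<longlongrightarrow> 1) at_top"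
proof -
  have "((\<lambda>t::real. 1 + a / t) \<longlongrightarrow> 1 + 0) at_top"
    by (intro tendsto_intros tendsto_divide_0[OF tendsto_const] filterlim_at_top_imp_at_infinity filterlim_ident)
  moreover have "\<forall>\<^sub>F t::real in at_top. 1 + a / t = (t + a) / t"
    using eventually_gt_at_top[of 0] by eventually_elim (simp add: field_simps)
  ultimately show ?thesis by (simp add: tendsto_cong)
qed

lemma shifted_power_ratio_tendsto_1: "((\<lambda>t::real. (t + a) ^ n / t ^ n) \<longlongrightarrow> 1) at_top"
  using tendsto_power[OF shifted_ratio_tendsto_1, of a n] by (simp add: power_divide)

lemma shifted_power_ratio_tendsto_0:
  assumes "m < n"
  shows "((\<lambda>t::real. (t + a) ^ m / t ^ n) \<longlongrightarrow> 0) at_top"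
proof -
  have "((\<lambda>t::real. ((t + a) ^ m / t ^ m) * (1 / t) ^ (n - m)) \<longlongrightarrow> 1 * 0 ^ (n - m)) at_top"
    by (intro tendsto_mult shifted_power_ratio_tendsto_1 tendsto_power tendsto_divide_0[OF tendsto_const]
        filterlim_at_top_imp_at_infinity filterlim_ident)
  moreover have "((t + a) ^ m / t ^ m) * (1 / t) ^ (n - m) = (t + a) ^ m / t ^ n" for t
    using assms by (simp add: power_divide flip: power_add)
  moreover have "(0::real) ^ (n - m) = 0" using assms by (simp add: power_0_left)
  ultimately show ?thesis by (simp only: mult_zero_right)
qed

lemma powr_at_top:
  assumes "0 < a"
  shows "filterlim (\<lambda>x::real. x powr a) at_top at_top"
proof -
  have "filterlim (\<lambda>x::real. exp (a * ln x)) at_top at_top"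
    using assms by (intro filterlim_compose[OF exp_at_top] ln_at_top
        filterlim_tendsto_pos_mult_at_top[OF tendsto_const])
  moreover have "\<forall>\<^sub>F x::real in at_top. exp (a * ln x) = x powr a"
    using eventually_gt_at_top[of 0] by eventually_elim (simp add: powr_def)
  ultimately show ?thesis by (simp cong: filterlim_cong)
qed

lemma f_min_tendsto:
  fixes T :: "nat \<Rightarrow> real"
  assumes inf: "infinite (UNIV :: 'k::field set)" and e: "3 \<le> e" and i: "1 \<le> i" "2 * i \<le> e"
    and T: "\<And>r. T r ^ (e - 1) = fact (e - 1) * real r" "filterlim T at_top sequentially"
  shows "(\<lambda>r. real (f_min TYPE('k) e i r) / T r ^ (e - i))
    \<longlonglongrightarrow> (if 2 * i < e then 1 else 2) / fact (e - i)" (is "_ \<longlonglongrightarrow> ?C / _")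
proof (rule tendsto_sandwich)
  have big: "\<forall>\<^sub>F r in sequentially. 4 * fact (e - 1) \<le> T r \<and> real e + 5 \<le> T r"
    using T(2) by (simp add: filterlim_at_top eventually_conj)
  show "\<forall>\<^sub>F r in sequentially. ?C * ((T r + - (real e + 2)) ^ (e - i) / T r ^ (e - i)) / fact (e - i)
      \<le> real (f_min TYPE('k) e i r) / T r ^ (e - i)"
    using big
  proof eventually_elim
    case (elim r)
    then have "?C * ((T r - (real e + 2)) ^ (e - i) / fact (e - i)) / T r ^ (e - i)
        \<le> real (f_min TYPE('k) e i r) / T r ^ (e - i)"
      using f_min_bounds(1)[OF inf e i T(1)[of r]] by (intro divide_right_mono) auto
    then show ?case
      by (simp only: times_divide_eq_right divide_divide_eq_left mult.commute add_uminus_conv_diff)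
  qed
  show "\<forall>\<^sub>F r in sequentially. real (f_min TYPE('k) e i r) / T r ^ (e - i) \<le>
      ((T r + (real e + 1)) ^ i / T r ^ (e - i)) / fact i +
      ((T r + (real e + 1)) ^ (e - i) / T r ^ (e - i)) / fact (e - i)"
    using big
  proof eventually_elim
    case (elim r)
    then have "real (f_min TYPE('k) e i r) / T r ^ (e - i)
      \<le> ((T r + (real e + 1)) ^ i / fact i + (T r + (real e + 1)) ^ (e - i) / fact (e - i)) / T r ^ (e - i)"
      using f_min_bounds(2)[OF inf e i T(1)[of r]] by (intro divide_right_mono) auto
    then show ?case by (simp add: add_divide_distrib mult.commute)
  qed
  note comp = filterlim_compose[OF _ T(2)]
  have "(\<lambda>r. ?C * ((T r + - (real e + 2)) ^ (e - i) / T r ^ (e - i)) / fact (e - i))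
      \<longlonglongrightarrow> ?C * 1 / fact (e - i)"
    by (intro tendsto_intros comp[OF shifted_power_ratio_tendsto_1]) simp
  then show "(\<lambda>r. ?C * ((T r + - (real e + 2)) ^ (e - i) / T r ^ (e - i)) / fact (e - i))
      \<longlonglongrightarrow> ?C / fact (e - i)" by simp
  \<comment> \<open>The contribution of \<open>forms_dim i m\<close> is negligible for
    \<open>i < e - i\<close>; in the middle degree it has the same order as the other term and
    doubles the limit.\<close>
  have lim: "(\<lambda>r. (T r + (real e + 1)) ^ i / T r ^ (e - i)) \<longlonglongrightarrow> ?C - 1"
  proof (cases "2 * i < e")
    case True
    then show ?thesis using comp[OF shifted_power_ratio_tendsto_0[of i "e - i"]] by simp
  next
    case False
    then have "e - i = i" using i by simp
    then show ?thesis using comp[OF shifted_power_ratio_tendsto_1[of _ i]] False by simp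
  qed
  have "(\<lambda>r. ((T r + (real e + 1)) ^ i / T r ^ (e - i)) / fact i +
      ((T r + (real e + 1)) ^ (e - i) / T r ^ (e - i)) / fact (e - i))
      \<longlonglongrightarrow> (?C - 1) / fact i + 1 / fact (e - i)"
    by (intro tendsto_intros lim comp[OF shifted_power_ratio_tendsto_1]) simp_all
  moreover have "(?C - 1) / fact i + 1 / fact (e - i) = ?C / (fact (e - i) :: real)"
  proof (cases "2 * i < e")
    case False
    then have "e - i = i" using i by simp
    then show ?thesis using False by simp
  qed simp
  ultimately show "(\<lambda>r. ((T r + (real e + 1)) ^ i / T r ^ (e - i)) / fact i +
      ((T r + (real e + 1)) ^ (e - i) / T r ^ (e - i)) / fact (e - i)) \<longlonglongrightarrow> ?C / fact (e - i)"
    by simp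
qed

theorem theorem3p6:
  fixes e i :: nat
  assumes "infinite (UNIV :: ('k::field) set)"
    and "e \<ge> 3" and "1 \<le> i" and "2 * i \<le> e"
  shows "(\<lambda>r. real (f_min TYPE('k) e i r) / real r powr ((real e - real i) / (real e - 1)))
     \<longlonglongrightarrow>
     (if 2 * i < e
      then (fact (e - 1)) powr ((real e - real i) / (real e - 1)) / fact (e - i)
      else 2 * ((fact (e - 1)) powr ((real e / 2) / (real e - 1)) / fact (e div 2)))"
proof -
  let ?\<alpha> = "(real e - real i) / (real e - 1)"
  \<comment> \<open>The real solution of \<open>T r ^ (e - 1) = fact (e - 1) * r\<close>.\<close>
  define T where "T r = (fact (e - 1) * real r) powr (1 / (real e - 1))" for r
  have e1: "real (e - 1) = real e - 1" "0 < real e - 1" "e - 1 \<noteq> 0" using assms(2) by auto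
  have ei: "real (e - i) = real e - real i" "e - i \<noteq> 0" using assms(3,4) by auto
  \<comment> \<open>A nonzero exponent makes the formula hold at \<open>r = 0\<close> as well, where
    both sides are 0.\<close>
  have T_power: "T r ^ n = (fact (e - 1) * real r) powr (real n / (real e - 1))" if "n \<noteq> 0" for n r
    using that e1 by (cases "r = 0") (simp_all add: T_def powr_powr flip: powr_realpow)
  have T1: "T r ^ (e - 1) = fact (e - 1) * real r" for r
    using T_power[OF e1(3), of r] e1 by (simp add: powr_one)
  have T2: "T r ^ (e - i) = fact (e - 1) powr ?\<alpha> * real r powr ?\<alpha>" for r
    using T_power[OF ei(2), of r] ei(1) by (simp add: powr_mult)
  have "filterlim (\<lambda>r. fact (e - 1) * real r) at_top sequentially"
    by (intro filterlim_tendsto_pos_mult_at_top[OF tendsto_const] filterlim_real_sequentially) simp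
  then have "filterlim T at_top sequentially"
    unfolding T_def[abs_def] using e1
    by (intro filterlim_compose[OF powr_at_top]) auto
  from f_min_tendsto[OF assms T1 this]
  have "(\<lambda>r. fact (e - 1) powr ?\<alpha> * (real (f_min TYPE('k) e i r) / T r ^ (e - i)))
      \<longlonglongrightarrow> fact (e - 1) powr ?\<alpha> * ((if 2 * i < e then 1 else 2) / fact (e - i))"
    by (intro tendsto_mult tendsto_const)
  moreover have "fact (e - 1) powr ?\<alpha> * (real (f_min TYPE('k) e i r) / T r ^ (e - i))
      = real (f_min TYPE('k) e i r) / real r powr ?\<alpha>" for r
    by (simp add: T2)
  moreover have "fact (e - 1) powr ?\<alpha> * ((if 2 * i < e then 1 else 2) / fact (e - i)) =
     (if 2 * i < e
      then (fact (e - 1)) powr ((real e - real i) / (real e - 1)) / fact (e - i)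
      else 2 * ((fact (e - 1)) powr ((real e / 2) / (real e - 1)) / fact (e div 2)))"
  proof (cases "2 * i < e")
    case False
    then have "e - i = e div 2" "real e - real i = real e / 2" using assms(4) by auto
    then show ?thesis using False by simp
  qed simp
  ultimately show ?thesis by (simp only:)
qed

end
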